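(* Let $R$ be a ring, $\sigma$ an automorphism of $R$, $\delta$ a locally nilpotent $\sigma$-derivation of $R$, and $A=R(x;\sigma,\delta)$ the skew Ore polynomial ring. Let $M_R$ be a right $R$-module. If $M_R$ is completely $(\sigma,\delta)$-compatible and $N_R$ is an essential submodule of $M_R$, then $N[x^{-1}]_A$ is an essential submodule of the right $A$-module $M[x^{-1}]_A$.
   Context: Rings are associative with identity, not necessarily commutative; modules are right modules. A $\sigma$-derivation of $R$ is an additive map $\delta:R\to R$ with $\delta(rs)=\sigma(r)\delta(s)+\delta(r)s$ for all $r,s\in R$. It is locally nilpotent if for every $r\in R$ there is $n(r)\ge 1$ with $\delta^{n(r)}(r)=0$. Skew Ore polynomial ring: $A=R(x;\sigma,\delta)$ is the (associative) ring containing $R$ and an element $x$, whose elements are uniquely representable as $r_0+r_1x+\cdots+r_kx^k$ with $r_i\in R$, $k\in\mathbb N$, and with commutation rule $xr=\sigma(r)x+x\delta(r)x$ for all $r\in R$; equivalently $xr=\sigma(r)x+\sigma\delta(r)x^2+\cdots+\sigma\delta^{n(r)-1}(r)x^{n(r)}$. That these data define such a ring $A$ is part of the setting. Inverse polynomial module: put $\sigma'=\sigma^{-1}$ and $\delta'=-\delta\sigma^{-1}$. For $0\le i\le k$ let $f_k^i:R\to R$ be the sum of all words (compositions) in $\sigma',\delta'$ with $i$ letters $\sigma'$ and $k-i$ letters $\delta'$ ($f_0^0=\mathrm{id}$). For a right $R$-module $M_R$, $M[x^{-1}]$ is the additive group of formal polynomials $m_0+m_1x^{-1}+\cdots+m_kx^{-k}$,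 $m_i\in M$, $k\in\mathbb N$. It is a right $A$-module via $(mx^{-k})r=\sum_{i=0}^k m f_k^i(r)x^{-i}$ for $r\in R$ (the iteration of $mx^{-1}r=m\sigma'(r)x^{-1}+m\delta'(r)$) and $(mx^{-i})x^j=mx^{-i+j}$ if $j\le i$ and $0$ if $j>i$. For a submodule $N_R\subseteq M_R$, $N[x^{-1}]_A$ is the $A$-submodule of polynomials with all coefficients in $N$. Compatibility: a module $L_R$ is $\sigma$-compatible if for all $l\in L$, $r\in R$: $lr=0\iff l\sigma(r)=0$; it is $\delta$-compatible if $lr=0$ implies $l\delta(r)=0$. $M_R$ is completely $(\sigma,\delta)$-compatible if for every submodule $N_R\subseteq M_R$ the quotient $(M/N)_R$ is both $\sigma$-compatible and $\delta$-compatible. A submodule $N$ of $M$ is essential if $mR\cap N\neq 0$ for every non-zero $m\in M$ (and likewise for $A$-modules). *)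

theory Defs
  imports "HOL-Algebra.Algebra"
begin

section \<open>Right modules over a possibly noncommutative ring\<close>

text \<open>As for the library's record \<open>module\<close>, the fields \<open>mult\<close> and \<open>one\<close> inherited from \<open>ring\<close>
  carry no meaning. The library's \<open>module\<close> locale itself requires a commutative ring.\<close>

record ('m, 'r) right_module = "'m ring" +
  rsmult :: "'m \<Rightarrow> 'r \<Rightarrow> 'm" (infixl "\<bullet>\<index>" 70)

locale right_module = R?: ring R + M?: abelian_group M
  for R :: "('r, 'b) ring_scheme" (structure)
    and M :: "('m, 'r, 'c) right_module_scheme" (structure) +
  assumes rsmult_closed: "\<lbrakk>m \<in> carrier M; r \<in> carrier R\<rbrakk> \<Longrightarrow> m \<bullet>\<^bsub>M\<^esub> r \<in> carrier M"
    and rsmult_l_distr: "\<lbrakk>m \<in> carrier M; n \<in> carrier M; r \<in> carrier R\<rbrakk>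
      \<Longrightarrow> (m \<oplus>\<^bsub>M\<^esub> n) \<bullet>\<^bsub>M\<^esub> r = m \<bullet>\<^bsub>M\<^esub> r \<oplus>\<^bsub>M\<^esub> n \<bullet>\<^bsub>M\<^esub> r"
    and rsmult_r_distr: "\<lbrakk>m \<in> carrier M; r \<in> carrier R; s \<in> carrier R\<rbrakk>
      \<Longrightarrow> m \<bullet>\<^bsub>M\<^esub> (r \<oplus>\<^bsub>R\<^esub> s) = m \<bullet>\<^bsub>M\<^esub> r \<oplus>\<^bsub>M\<^esub> m \<bullet>\<^bsub>M\<^esub> s"
    and rsmult_assoc: "\<lbrakk>m \<in> carrier M; r \<in> carrier R; s \<in> carrier R\<rbrakk>
      \<Longrightarrow> m \<bullet>\<^bsub>M\<^esub> (r \<otimes>\<^bsub>R\<^esub> s) = (m \<bullet>\<^bsub>M\<^esub> r) \<bullet>\<^bsub>M\<^esub> s"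
    and rsmult_one: "m \<in> carrier M \<Longrightarrow> m \<bullet>\<^bsub>M\<^esub> \<one>\<^bsub>R\<^esub> = m"

locale right_submodule = right_module R M + additive_subgroup N M
  for N and R :: "('r, 'b) ring_scheme" (structure)
    and M :: "('m, 'r, 'c) right_module_scheme" (structure) +
  assumes sub_rsmult_closed: "\<lbrakk>n \<in> N; r \<in> carrier R\<rbrakk> \<Longrightarrow> n \<bullet>\<^bsub>M\<^esub> r \<in> N"

locale essential_submodule = right_submodule +
  assumes essential: "\<lbrakk>m \<in> carrier M; m \<noteq> \<zero>\<^bsub>M\<^esub>\<rbrakk>
    \<Longrightarrow> (\<lambda>r. m \<bullet>\<^bsub>M\<^esub> r) ` carrier R \<inter> N \<noteq> {\<zero>\<^bsub>M\<^esub>}"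

definition quotient_rmodule ::
  "('m, 'r, 'c) right_module_scheme \<Rightarrow> 'm set \<Rightarrow> ('m set, 'r) right_module" where
  "quotient_rmodule M N =
    \<lparr>carrier = a_rcosets\<^bsub>M\<^esub> N, monoid.mult = undefined, one = undefined,
     ring.zero = N, ring.add = (<+>\<^bsub>M\<^esub>),
     rsmult = (\<lambda>Y r. \<Union>m\<in>Y. N +>\<^bsub>M\<^esub> (m \<bullet>\<^bsub>M\<^esub> r))\<rparr>"


section \<open>Compatibility\<close>

definition sigma_compatible ::
  "('r, 'b) ring_scheme \<Rightarrow> ('r \<Rightarrow> 'r) \<Rightarrow> ('m, 'r, 'c) right_module_scheme \<Rightarrow> bool" where
  "sigma_compatible R \<sigma> L \<longleftrightarrow>
    (\<forall>l\<in>carrier L. \<forall>r\<in>carrier R. l \<bullet>\<^bsub>L\<^esub> r = \<zero>\<^bsub>L\<^esub> \<longleftrightarrow> l \<bullet>\<^bsub>L\<^esub> \<sigma> r = \<zero>\<^bsub>L\<^esub>)"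

definition delta_compatible ::
  "('r, 'b) ring_scheme \<Rightarrow> ('r \<Rightarrow> 'r) \<Rightarrow> ('m, 'r, 'c) right_module_scheme \<Rightarrow> bool" where
  "delta_compatible R \<delta> L \<longleftrightarrow>
    (\<forall>l\<in>carrier L. \<forall>r\<in>carrier R. l \<bullet>\<^bsub>L\<^esub> r = \<zero>\<^bsub>L\<^esub> \<longrightarrow> l \<bullet>\<^bsub>L\<^esub> \<delta> r = \<zero>\<^bsub>L\<^esub>)"

definition completely_compatible ::
  "('r, 'b) ring_scheme \<Rightarrow> ('r \<Rightarrow> 'r) \<Rightarrow> ('r \<Rightarrow> 'r) \<Rightarrow> ('m, 'r, 'c) right_module_scheme \<Rightarrow> bool"
  where
  "completely_compatible R \<sigma> \<delta> M \<longleftrightarrow>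
    (\<forall>N. right_submodule N R M \<longrightarrow>
      sigma_compatible R \<sigma> (quotient_rmodule M N) \<and>
      delta_compatible R \<delta> (quotient_rmodule M N))"


section \<open>Skew Ore polynomial rings\<close>

definition skew_derivation ::
  "('r, 'b) ring_scheme \<Rightarrow> ('r \<Rightarrow> 'r) \<Rightarrow> ('r \<Rightarrow> 'r) \<Rightarrow> bool" where
  "skew_derivation R \<sigma> \<delta> \<longleftrightarrow>
    \<delta> \<in> carrier R \<rightarrow> carrier R \<and>
    (\<forall>r\<in>carrier R. \<forall>s\<in>carrier R. \<delta> (r \<oplus>\<^bsub>R\<^esub> s) = \<delta> r \<oplus>\<^bsub>R\<^esub> \<delta> s) \<and>
    (\<forall>r\<in>carrier R. \<forall>s\<in>carrier R.
      \<delta> (r \<otimes>\<^bsub>R\<^esub> s) = \<sigma> r \<otimes>\<^bsub>R\<^esub> \<delta> s \<oplus>\<^bsub>R\<^esub> \<delta> r \<otimes>\<^bsub>R\<^esub> s)"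

definition locally_nilpotent :: "('r, 'b) ring_scheme \<Rightarrow> ('r \<Rightarrow> 'r) \<Rightarrow> bool" where
  "locally_nilpotent R \<delta> \<longleftrightarrow> (\<forall>r\<in>carrier R. \<exists>n\<ge>1. (\<delta> ^^ n) r = \<zero>\<^bsub>R\<^esub>)"

text \<open>Coefficient families of polynomials: finitely supported sequences in the carrier. Only the
  additive structure of the first argument is used, so it serves rings and modules alike.\<close>

definition coeff_seqs :: "('a, 'b) ring_scheme \<Rightarrow> (nat \<Rightarrow> 'a) set" where
  "coeff_seqs G = {c. (\<forall>i. c i \<in> carrier G) \<and> finite {i. c i \<noteq> \<zero>\<^bsub>G\<^esub>}}"

definition left_expansion ::
  "('r, 'b) ring_scheme \<Rightarrow> ('a, 'c) ring_scheme \<Rightarrow> ('r \<Rightarrow> 'a) \<Rightarrow> 'a \<Rightarrow> 'a \<Rightarrow> (nat \<Rightarrow> 'r) \<Rightarrow> bool"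
  where
  "left_expansion R A \<iota> x a c \<longleftrightarrow>
    c \<in> coeff_seqs R \<and>
    a = (\<Oplus>\<^bsub>A\<^esub>i\<in>{i. c i \<noteq> \<zero>\<^bsub>R\<^esub>}. \<iota> (c i) \<otimes>\<^bsub>A\<^esub> x [^]\<^bsub>A\<^esub> i)"

text \<open>\<open>A\<close> is \<open>R(x; \<sigma>, \<delta>)\<close>, with \<open>R\<close> regarded as a subring along the embedding \<open>\<iota>\<close>. Existence is
  assumed, not constructed: associativity of \<open>A\<close> on \<open>x r s\<close> forces in addition the identity
  \<open>\<delta> (r s) = r \<delta> (s) + \<delta> (r) \<sigma> (s)\<close>, which a general \<open>\<sigma>\<close>-derivation need not satisfy.\<close>

locale skew_Ore_ring = R?: ring R + A?: ring A
  for R :: "('r, 'b) ring_scheme" (structure) and A :: "('a, 'd) ring_scheme" (structure) +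
  fixes \<sigma> \<delta> :: "'r \<Rightarrow> 'r" and \<iota> :: "'r \<Rightarrow> 'a" and x :: 'a
  assumes embed_hom: "\<iota> \<in> ring_hom R A"
    and embed_inj: "inj_on \<iota> (carrier R)"
    and x_closed: "x \<in> carrier A"
    and unique_expansion: "a \<in> carrier A \<Longrightarrow> \<exists>!c. left_expansion R A \<iota> x a c"
    and commutation: "r \<in> carrier R \<Longrightarrow>
      x \<otimes>\<^bsub>A\<^esub> \<iota> r = \<iota> (\<sigma> r) \<otimes>\<^bsub>A\<^esub> x \<oplus>\<^bsub>A\<^esub> x \<otimes>\<^bsub>A\<^esub> \<iota> (\<delta> r) \<otimes>\<^bsub>A\<^esub> x"

definition left_coeffs ::
  "('r, 'b) ring_scheme \<Rightarrow> ('a, 'c) ring_scheme \<Rightarrow> ('r \<Rightarrow> 'a) \<Rightarrow> 'a \<Rightarrow> 'a \<Rightarrow> nat \<Rightarrow> 'r" where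
  "left_coeffs R A \<iota> x a = (THE c. left_expansion R A \<iota> x a c)"


section \<open>Inverse polynomial modules\<close>

definition sigma' :: "('r, 'b) ring_scheme \<Rightarrow> ('r \<Rightarrow> 'r) \<Rightarrow> 'r \<Rightarrow> 'r" where
  "sigma' R \<sigma> = inv_into (carrier R) \<sigma>"

definition delta' :: "('r, 'b) ring_scheme \<Rightarrow> ('r \<Rightarrow> 'r) \<Rightarrow> ('r \<Rightarrow> 'r) \<Rightarrow> 'r \<Rightarrow> 'r" where
  "delta' R \<sigma> \<delta> r = \<ominus>\<^bsub>R\<^esub> \<delta> (sigma' R \<sigma> r)"

text \<open>A word is a list of Booleans: \<open>True\<close> is the letter \<open>\<sigma>'\<close>, \<open>False\<close> the letter \<open>\<delta>'\<close>. The sum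
  \<open>word_sum R \<sigma> \<delta> k i\<close> is \<open>f\<^sub>k\<^sup>i\<close>.\<close>

definition word_map ::
  "('r, 'b) ring_scheme \<Rightarrow> ('r \<Rightarrow> 'r) \<Rightarrow> ('r \<Rightarrow> 'r) \<Rightarrow> bool list \<Rightarrow> 'r \<Rightarrow> 'r" where
  "word_map R \<sigma> \<delta> w = foldr (\<lambda>b. if b then sigma' R \<sigma> else delta' R \<sigma> \<delta>) w"

definition word_sum ::
  "('r, 'b) ring_scheme \<Rightarrow> ('r \<Rightarrow> 'r) \<Rightarrow> ('r \<Rightarrow> 'r) \<Rightarrow> nat \<Rightarrow> nat \<Rightarrow> 'r \<Rightarrow> 'r" where
  "word_sum R \<sigma> \<delta> k i r =
    (\<Oplus>\<^bsub>R\<^esub>w\<in>{w. length w = k \<and> count_list w True = i}. word_map R \<sigma> \<delta> w r)"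

text \<open>The element \<open>m\<^sub>0 + m\<^sub>1 x\<^sup>-\<^sup>1 + \<dots> + m\<^sub>k x\<^sup>-\<^sup>k\<close> is the sequence of its coefficients. The next
  two functions are the additive extensions of \<open>(m x\<^sup>-\<^sup>k) r = \<Sum>i\<le>k. m f\<^sub>k\<^sup>i(r) x\<^sup>-\<^sup>i\<close> and of
  \<open>(m x\<^sup>-\<^sup>i) x\<^sup>j = m x\<^sup>-\<^sup>i\<^sup>+\<^sup>j\<close> (zero for \<open>j > i\<close>), read off coefficientwise.\<close>

definition inv_poly_scale ::
  "('r, 'b) ring_scheme \<Rightarrow> ('r \<Rightarrow> 'r) \<Rightarrow> ('r \<Rightarrow> 'r) \<Rightarrow> ('m, 'r, 'c) right_module_scheme \<Rightarrow>
    (nat \<Rightarrow> 'm) \<Rightarrow> 'r \<Rightarrow> nat \<Rightarrow> 'm" where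
  "inv_poly_scale R \<sigma> \<delta> M p r =
    (\<lambda>i. \<Oplus>\<^bsub>M\<^esub>k\<in>{k. i \<le> k \<and> p k \<noteq> \<zero>\<^bsub>M\<^esub>}. p k \<bullet>\<^bsub>M\<^esub> word_sum R \<sigma> \<delta> k i r)"

definition inv_poly_shift :: "(nat \<Rightarrow> 'm) \<Rightarrow> nat \<Rightarrow> nat \<Rightarrow> 'm" where
  "inv_poly_shift p j = (\<lambda>i. p (i + j))"

text \<open>An element \<open>a = r\<^sub>0 + r\<^sub>1 x + \<dots>\<close> of \<open>A\<close> acts by \<open>p a = p r\<^sub>0 + (p r\<^sub>1) x + \<dots>\<close>.\<close>

definition inv_poly_module ::
  "('r, 'b) ring_scheme \<Rightarrow> ('r \<Rightarrow> 'r) \<Rightarrow> ('r \<Rightarrow> 'r) \<Rightarrow>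
    ('a, 'd) ring_scheme \<Rightarrow> ('r \<Rightarrow> 'a) \<Rightarrow> 'a \<Rightarrow>
    ('m, 'r, 'c) right_module_scheme \<Rightarrow> (nat \<Rightarrow> 'm, 'a) right_module" where
  "inv_poly_module R \<sigma> \<delta> A \<iota> x M =
    \<lparr>carrier = coeff_seqs M, monoid.mult = undefined, one = undefined,
     ring.zero = (\<lambda>i. \<zero>\<^bsub>M\<^esub>), ring.add = (\<lambda>p q i. p i \<oplus>\<^bsub>M\<^esub> q i),
     rsmult = (\<lambda>p a i. let c = left_coeffs R A \<iota> x a in
       \<Oplus>\<^bsub>M\<^esub>j\<in>{j. c j \<noteq> \<zero>\<^bsub>R\<^esub>}. inv_poly_shift (inv_poly_scale R \<sigma> \<delta> M p (c j)) j i)\<rparr>"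

definition inv_poly_sub :: "('m, 'r, 'c) right_module_scheme \<Rightarrow> 'm set \<Rightarrow> (nat \<Rightarrow> 'm) set" where
  "inv_poly_sub M N = {p \<in> coeff_seqs M. \<forall>i. p i \<in> N}"

end

theory Submission
  imports Defs
begin

text \<open>Multiplying \<open>p\<close> by \<open>x\<close> to its degree leaves the leading coefficient of \<open>p\<close> as a constant, and
  on constants \<open>R\<close> acts as on \<open>M\<close>; so essentiality of \<open>N\<close> in \<open>M\<close> applies directly. The work lies in
  showing that the coefficientwise action makes the inverse polynomials an \<open>A\<close>-module. Associativity
  over \<open>R\<close> amounts to \<open>f\<^sub>k\<^sup>i(rs) = \<Sum>j. f\<^sub>k\<^sup>j(r) f\<^sub>j\<^sup>i(s)\<close>, which rests on the twisted Leibniz rule that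
  associativity of \<open>A\<close> imposes on \<open>\<delta>\<close>; compatibility with \<open>x r = \<sigma>(r) x + x \<delta>(r) x\<close> follows by
  induction on the nilpotency index of \<open>\<delta>\<close> at \<open>r\<close>.\<close>

section \<open>Finitely supported sequences and finite sums\<close>

lemma coeff_seqs_iff:
  "c \<in> coeff_seqs G \<longleftrightarrow> (\<forall>i. c i \<in> carrier G) \<and> (\<exists>n. \<forall>i>n. c i = \<zero>\<^bsub>G\<^esub>)"
  unfolding coeff_seqs_def finite_nat_set_iff_bounded_le
  by (auto simp: not_less[symmetric])

lemma coeff_seqsE:
  assumes "c \<in> coeff_seqs G"
  obtains n where "\<And>i. c i \<in> carrier G" "\<And>i. i > n \<Longrightarrow> c i = \<zero>\<^bsub>G\<^esub>"
  using assms unfolding coeff_seqs_iff by blast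

lemma coeff_seqsI:
  "\<lbrakk>\<And>i. c i \<in> carrier G; \<And>i. i > n \<Longrightarrow> c i = \<zero>\<^bsub>G\<^esub>\<rbrakk> \<Longrightarrow> c \<in> coeff_seqs G"
  unfolding coeff_seqs_iff by blast

lemma coeff_seqs_closed: "c \<in> coeff_seqs G \<Longrightarrow> c i \<in> carrier G"
  unfolding coeff_seqs_iff by blast

context abelian_monoid
begin

lemma finsum_swap:
  assumes "finite S" "finite T" "\<And>i j. i \<in> S \<Longrightarrow> j \<in> T \<Longrightarrow> f i j \<in> carrier G"
  shows "(\<Oplus>i\<in>S. \<Oplus>j\<in>T. f i j) = (\<Oplus>j\<in>T. \<Oplus>i\<in>S. f i j)"
  using assms(1,3)
proof (induction S)
  case (insert s S)
  have "(\<Oplus>j\<in>T. \<Oplus>i\<in>insert s S. f i j) = (\<Oplus>j\<in>T. f s j \<oplus> (\<Oplus>i\<in>S. f i j))"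
    using insert by (intro finsum_cong') (auto intro!: finsum_closed)
  also have "\<dots> = (\<Oplus>j\<in>T. f s j) \<oplus> (\<Oplus>j\<in>T. \<Oplus>i\<in>S. f i j)"
    using insert by (intro finsum_addf) (auto intro!: finsum_closed)
  also have "\<dots> = (\<Oplus>i\<in>insert s S. \<Oplus>j\<in>T. f i j)"
    using insert by (subst finsum_insert) (auto intro!: finsum_closed)
  finally show ?case by simp
qed simp

lemma finsum_zeroI: "(\<And>i. i \<in> S \<Longrightarrow> f i = \<zero>) \<Longrightarrow> finsum G f S = \<zero>"
  by (rule add.finprod_one_eqI)

lemma coeff_seqs_zero: "(\<lambda>i. \<zero>) \<in> coeff_seqs G"
  by (rule coeff_seqsI[where n = 0]) auto

lemma coeff_seqs_add:
  assumes "p \<in> coeff_seqs G" "q \<in> coeff_seqs G"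
  shows "(\<lambda>i. p i \<oplus> q i) \<in> coeff_seqs G"
proof -
  obtain n where n: "\<And>i. p i \<in> carrier G" "\<And>i. i > n \<Longrightarrow> p i = \<zero>"
    using assms(1) by (rule coeff_seqsE) blast
  obtain m where m: "\<And>i. q i \<in> carrier G" "\<And>i. i > m \<Longrightarrow> q i = \<zero>"
    using assms(2) by (rule coeff_seqsE) blast
  show ?thesis
    by (rule coeff_seqsI[where n = "max n m"]) (auto simp: n m)
qed

end

lemma inv_poly_shift_closed:
  assumes "p \<in> coeff_seqs M"
  shows "inv_poly_shift p j \<in> coeff_seqs M"
proof -
  obtain n where n: "\<And>i. p i \<in> carrier M" "\<And>i. i > n \<Longrightarrow> p i = \<zero>\<^bsub>M\<^esub>"
    using assms by (rule coeff_seqsE) blast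
  show ?thesis
    by (rule coeff_seqsI[where n = n]) (auto simp: inv_poly_shift_def n)
qed

section \<open>Skew Ore polynomials\<close>

locale skew_Ore_autom = skew_Ore_ring +
  assumes sigma_iso: "\<sigma> \<in> ring_iso R R"
    and delta_skew: "skew_derivation R \<sigma> \<delta>"
    and delta_nilpotent: "locally_nilpotent R \<delta>"
begin

section \<open>Elementary rules for \<sigma>, \<delta> and the embedding\<close>

lemma sigma_hom: "\<sigma> \<in> ring_hom R R" and sigma_bij: "bij_betw \<sigma> (carrier R) (carrier R)"
  using sigma_iso by (auto simp: ring_iso_def)

lemma sigma_closed [simp, intro]: "r \<in> carrier R \<Longrightarrow> \<sigma> r \<in> carrier R"
  using sigma_hom by (rule ring_hom_closed)

lemma sigma_zero [simp]: "\<sigma> \<zero>\<^bsub>R\<^esub> = \<zero>\<^bsub>R\<^esub>"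
  using ring_hom_zero[OF sigma_hom] R.ring_axioms by blast

lemma sigma_eq_zeroD: "\<lbrakk>r \<in> carrier R; \<sigma> r = \<zero>\<^bsub>R\<^esub>\<rbrakk> \<Longrightarrow> r = \<zero>\<^bsub>R\<^esub>"
  using sigma_bij sigma_zero by (metis R.zero_closed bij_betw_inv_into_left)

lemma delta_closed [simp, intro]: "r \<in> carrier R \<Longrightarrow> \<delta> r \<in> carrier R"
  using delta_skew by (auto simp: skew_derivation_def)

lemma delta_add:
  "\<lbrakk>r \<in> carrier R; s \<in> carrier R\<rbrakk> \<Longrightarrow> \<delta> (r \<oplus>\<^bsub>R\<^esub> s) = \<delta> r \<oplus>\<^bsub>R\<^esub> \<delta> s"
  using delta_skew by (auto simp: skew_derivation_def)

lemma delta_mult: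
  "\<lbrakk>r \<in> carrier R; s \<in> carrier R\<rbrakk>
    \<Longrightarrow> \<delta> (r \<otimes>\<^bsub>R\<^esub> s) = \<sigma> r \<otimes>\<^bsub>R\<^esub> \<delta> s \<oplus>\<^bsub>R\<^esub> \<delta> r \<otimes>\<^bsub>R\<^esub> s"
  using delta_skew by (auto simp: skew_derivation_def)

lemma delta_zero [simp]: "\<delta> \<zero>\<^bsub>R\<^esub> = \<zero>\<^bsub>R\<^esub>"
  using delta_add[of "\<zero>\<^bsub>R\<^esub>" "\<zero>\<^bsub>R\<^esub>"] by (simp add: R.add.r_cancel_one')

lemma delta_one [simp]: "\<delta> \<one>\<^bsub>R\<^esub> = \<zero>\<^bsub>R\<^esub>"
  using delta_mult[of "\<one>\<^bsub>R\<^esub>" "\<one>\<^bsub>R\<^esub>"] ring_hom_one[OF sigma_hom]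
  by (simp add: R.add.r_cancel_one')

lemma embed_closed [simp, intro]: "r \<in> carrier R \<Longrightarrow> \<iota> r \<in> carrier A"
  using embed_hom by (rule ring_hom_closed)

lemma embed_zero [simp]: "\<iota> \<zero>\<^bsub>R\<^esub> = \<zero>\<^bsub>A\<^esub>"
  using ring_hom_zero[OF embed_hom] R.ring_axioms A.ring_axioms by blast

lemma embed_one [simp]: "\<iota> \<one>\<^bsub>R\<^esub> = \<one>\<^bsub>A\<^esub>"
  using ring_hom_one[OF embed_hom] .

lemma embed_add:
  "\<lbrakk>r \<in> carrier R; s \<in> carrier R\<rbrakk> \<Longrightarrow> \<iota> (r \<oplus>\<^bsub>R\<^esub> s) = \<iota> r \<oplus>\<^bsub>A\<^esub> \<iota> s"
  using embed_hom by (rule ring_hom_add)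

lemma embed_mult:
  "\<lbrakk>r \<in> carrier R; s \<in> carrier R\<rbrakk> \<Longrightarrow> \<iota> (r \<otimes>\<^bsub>R\<^esub> s) = \<iota> r \<otimes>\<^bsub>A\<^esub> \<iota> s"
  using embed_hom by (rule ring_hom_mult)

declare x_closed [simp]

section \<open>Left coefficients in \<open>A\<close>\<close>

abbreviation "lc \<equiv> left_coeffs R A \<iota> x"

lemma left_expansion_left_coeffs:
  "a \<in> carrier A \<Longrightarrow> left_expansion R A \<iota> x a (lc a)"
  using theI'[OF unique_expansion] by (simp add: left_coeffs_def)

lemma left_coeffs_eqI:
  "\<lbrakk>a \<in> carrier A; left_expansion R A \<iota> x a c\<rbrakk> \<Longrightarrow> lc a = c"
  using unique_expansion left_expansion_left_coeffs by blast

lemma left_coeffs_seq: "a \<in> carrier A \<Longrightarrow> lc a \<in> coeff_seqs R"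
  using left_expansion_left_coeffs by (simp add: left_expansion_def)

lemma left_coeffs_closed [simp, intro]: "a \<in> carrier A \<Longrightarrow> lc a i \<in> carrier R"
  using left_coeffs_seq by (rule coeff_seqs_closed)

text \<open>The embedding sends zero to zero, so the sum over the support may be padded to an
  initial segment. Sums over \<open>{..n}\<close> are easily brought to a common range by enlarging
  \<open>n\<close>, which is why the computations below use them.\<close>

lemma left_expansion_iff:
  assumes "\<And>i. c i \<in> carrier R" "\<And>i. i > n \<Longrightarrow> c i = \<zero>\<^bsub>R\<^esub>"
  shows "left_expansion R A \<iota> x a c \<longleftrightarrow> a = (\<Oplus>\<^bsub>A\<^esub>i\<in>{..n}. \<iota> (c i) \<otimes>\<^bsub>A\<^esub> x [^]\<^bsub>A\<^esub> i)"
proof -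
  have "c \<in> coeff_seqs R"
    using assms by (rule coeff_seqsI)
  moreover have "(\<Oplus>\<^bsub>A\<^esub>i\<in>{i. c i \<noteq> \<zero>\<^bsub>R\<^esub>}. \<iota> (c i) \<otimes>\<^bsub>A\<^esub> x [^]\<^bsub>A\<^esub> i)
      = (\<Oplus>\<^bsub>A\<^esub>i\<in>{..n}. \<iota> (c i) \<otimes>\<^bsub>A\<^esub> x [^]\<^bsub>A\<^esub> i)"
    using assms by (intro A.add.finprod_mono_neutral_cong_left) (auto simp: not_less[symmetric])
  ultimately show ?thesis
    by (simp add: left_expansion_def)
qed

text \<open>The expansion is offered for every \<open>m \<ge> n\<close> so that two elements can be
  expanded over one range.\<close>

lemma left_coeffsE:
  assumes "a \<in> carrier A"
  obtains n where "\<And>i. i > n \<Longrightarrow> lc a i = \<zero>\<^bsub>R\<^esub>"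
    "\<And>m. m \<ge> n \<Longrightarrow> a = (\<Oplus>\<^bsub>A\<^esub>i\<in>{..m}. \<iota> (lc a i) \<otimes>\<^bsub>A\<^esub> x [^]\<^bsub>A\<^esub> i)"
proof -
  obtain n where n: "\<And>i. i > n \<Longrightarrow> lc a i = \<zero>\<^bsub>R\<^esub>"
    using left_coeffs_seq[OF assms] unfolding coeff_seqs_iff by blast
  show ?thesis
  proof
    show "a = (\<Oplus>\<^bsub>A\<^esub>i\<in>{..m}. \<iota> (lc a i) \<otimes>\<^bsub>A\<^esub> x [^]\<^bsub>A\<^esub> i)" if "m \<ge> n" for m
      using left_expansion_left_coeffs[OF assms] n that assms
        left_expansion_iff[of "lc a" m a]
      by auto
  qed (rule n)
qed

lemma left_coeffs_add:
  assumes "a \<in> carrier A" "b \<in> carrier A"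
  shows "lc (a \<oplus>\<^bsub>A\<^esub> b) = (\<lambda>i. lc a i \<oplus>\<^bsub>R\<^esub> lc b i)"
proof -
  obtain n where n: "\<And>i. i > n \<Longrightarrow> lc a i = \<zero>\<^bsub>R\<^esub>"
    "\<And>m. m \<ge> n \<Longrightarrow> a = (\<Oplus>\<^bsub>A\<^esub>i\<in>{..m}. \<iota> (lc a i) \<otimes>\<^bsub>A\<^esub> x [^]\<^bsub>A\<^esub> i)"
    using assms(1) by (rule left_coeffsE) blast
  obtain m where m: "\<And>i. i > m \<Longrightarrow> lc b i = \<zero>\<^bsub>R\<^esub>"
    "\<And>k. k \<ge> m \<Longrightarrow> b = (\<Oplus>\<^bsub>A\<^esub>i\<in>{..k}. \<iota> (lc b i) \<otimes>\<^bsub>A\<^esub> x [^]\<^bsub>A\<^esub> i)"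
    using assms(2) by (rule left_coeffsE) blast
  let ?k = "max n m"
  have "a \<oplus>\<^bsub>A\<^esub> b = (\<Oplus>\<^bsub>A\<^esub>i\<in>{..?k}. \<iota> (lc a i) \<otimes>\<^bsub>A\<^esub> x [^]\<^bsub>A\<^esub> i)
      \<oplus>\<^bsub>A\<^esub> (\<Oplus>\<^bsub>A\<^esub>i\<in>{..?k}. \<iota> (lc b i) \<otimes>\<^bsub>A\<^esub> x [^]\<^bsub>A\<^esub> i)"
    using n(2)[of ?k] m(2)[of ?k] by simp
  also have "\<dots> = (\<Oplus>\<^bsub>A\<^esub>i\<in>{..?k}. \<iota> (lc a i) \<otimes>\<^bsub>A\<^esub> x [^]\<^bsub>A\<^esub> i \<oplus>\<^bsub>A\<^esub> \<iota> (lc b i) \<otimes>\<^bsub>A\<^esub> x [^]\<^bsub>A\<^esub> i)"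
    using assms by (intro A.finsum_addf[symmetric]) auto
  also have "\<dots> = (\<Oplus>\<^bsub>A\<^esub>i\<in>{..?k}. \<iota> (lc a i \<oplus>\<^bsub>R\<^esub> lc b i) \<otimes>\<^bsub>A\<^esub> x [^]\<^bsub>A\<^esub> i)"
    using assms by (intro A.finsum_cong') (auto simp: embed_add A.l_distr)
  finally have "left_expansion R A \<iota> x (a \<oplus>\<^bsub>A\<^esub> b) (\<lambda>i. lc a i \<oplus>\<^bsub>R\<^esub> lc b i)"
    using assms n m by (subst left_expansion_iff[of _ ?k]) auto
  then show ?thesis
    using assms by (intro left_coeffs_eqI) auto
qed

text \<open>With the ring element on the left, no power of \<open>x\<close> has to be moved past it,
  so the commutation rule does not enter. \<open>poly_rsmult_embed_mult\<close> relies on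
  this.\<close>

lemma left_coeffs_embed_mult:
  assumes "r \<in> carrier R" "a \<in> carrier A"
  shows "lc (\<iota> r \<otimes>\<^bsub>A\<^esub> a) = (\<lambda>i. r \<otimes>\<^bsub>R\<^esub> lc a i)"
proof -
  obtain n where n: "\<And>i. i > n \<Longrightarrow> lc a i = \<zero>\<^bsub>R\<^esub>"
    "\<And>m. m \<ge> n \<Longrightarrow> a = (\<Oplus>\<^bsub>A\<^esub>i\<in>{..m}. \<iota> (lc a i) \<otimes>\<^bsub>A\<^esub> x [^]\<^bsub>A\<^esub> i)"
    using assms(2) by (rule left_coeffsE) blast
  have "\<iota> r \<otimes>\<^bsub>A\<^esub> a = \<iota> r \<otimes>\<^bsub>A\<^esub> (\<Oplus>\<^bsub>A\<^esub>i\<in>{..n}. \<iota> (lc a i) \<otimes>\<^bsub>A\<^esub> x [^]\<^bsub>A\<^esub> i)"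
    using n(2)[of n] by simp
  also have "\<dots> = (\<Oplus>\<^bsub>A\<^esub>i\<in>{..n}. \<iota> r \<otimes>\<^bsub>A\<^esub> (\<iota> (lc a i) \<otimes>\<^bsub>A\<^esub> x [^]\<^bsub>A\<^esub> i))"
    using assms by (intro A.finsum_rdistr) auto
  also have "\<dots> = (\<Oplus>\<^bsub>A\<^esub>i\<in>{..n}. \<iota> (r \<otimes>\<^bsub>R\<^esub> lc a i) \<otimes>\<^bsub>A\<^esub> x [^]\<^bsub>A\<^esub> i)"
    using assms by (intro A.finsum_cong') (auto simp: embed_mult A.m_assoc)
  finally have "left_expansion R A \<iota> x (\<iota> r \<otimes>\<^bsub>A\<^esub> a) (\<lambda>i. r \<otimes>\<^bsub>R\<^esub> lc a i)"
    using assms n by (subst left_expansion_iff[of _ n]) auto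
  then show ?thesis
    using assms by (intro left_coeffs_eqI) auto
qed

lemma left_coeffs_mult_x:
  assumes "a \<in> carrier A"
  shows "lc (a \<otimes>\<^bsub>A\<^esub> x) = case_nat \<zero>\<^bsub>R\<^esub> (lc a)"
proof -
  let ?c = "case_nat \<zero>\<^bsub>R\<^esub> (lc a)"
  obtain n where n: "\<And>i. i > n \<Longrightarrow> lc a i = \<zero>\<^bsub>R\<^esub>"
    "\<And>m. m \<ge> n \<Longrightarrow> a = (\<Oplus>\<^bsub>A\<^esub>i\<in>{..m}. \<iota> (lc a i) \<otimes>\<^bsub>A\<^esub> x [^]\<^bsub>A\<^esub> i)"
    using assms by (rule left_coeffsE) blast
  have c: "?c i \<in> carrier R" for i
    using assms by (cases i) auto
  have "a \<otimes>\<^bsub>A\<^esub> x = (\<Oplus>\<^bsub>A\<^esub>i\<in>{..n}. \<iota> (lc a i) \<otimes>\<^bsub>A\<^esub> x [^]\<^bsub>A\<^esub> i) \<otimes>\<^bsub>A\<^esub> x"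
    using n(2)[of n] by simp
  also have "\<dots> = (\<Oplus>\<^bsub>A\<^esub>i\<in>{..n}. (\<iota> (lc a i) \<otimes>\<^bsub>A\<^esub> x [^]\<^bsub>A\<^esub> i) \<otimes>\<^bsub>A\<^esub> x)"
    using assms by (intro A.finsum_ldistr) auto
  also have "\<dots> = (\<Oplus>\<^bsub>A\<^esub>i\<in>{..n}. \<iota> (?c (Suc i)) \<otimes>\<^bsub>A\<^esub> x [^]\<^bsub>A\<^esub> (Suc i))"
    using assms by (intro A.finsum_cong') (auto simp: A.m_assoc)
  also have "\<dots> = (\<Oplus>\<^bsub>A\<^esub>i\<in>{..Suc n}. \<iota> (?c i) \<otimes>\<^bsub>A\<^esub> x [^]\<^bsub>A\<^esub> i)"
    using c assms by (subst A.finsum_Suc2) auto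
  finally have "left_expansion R A \<iota> x (a \<otimes>\<^bsub>A\<^esub> x) ?c"
    using assms n c by (subst left_expansion_iff[of _ "Suc n"]) (auto split: nat.split)
  then show ?thesis
    using assms by (intro left_coeffs_eqI) auto
qed

lemma left_coeffs_embed:
  assumes "r \<in> carrier R"
  shows "lc (\<iota> r) = (\<lambda>i. if i = 0 then r else \<zero>\<^bsub>R\<^esub>)"
  using assms by (intro left_coeffs_eqI) (auto simp: left_expansion_iff[of _ 0])

lemma left_coeffs_zero: "lc \<zero>\<^bsub>A\<^esub> = (\<lambda>i. \<zero>\<^bsub>R\<^esub>)"
  using left_coeffs_embed[of "\<zero>\<^bsub>R\<^esub>"] by auto

text \<open>Horner's scheme: an element is
  \<open>r\<^sub>0 + (r\<^sub>1 + r\<^sub>2 x + ...) x\<close>. Peeling off the constant term leaves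
  a right multiple of \<open>x\<close>, whose left coefficients are a mere shift. In the proof the
  coefficient sequence is generalised because the induction hypothesis is applied to its
  shift.\<close>

lemma Ore_induct [consumes 1, case_names zero step]:
  assumes "a \<in> carrier A"
    and zero: "P \<zero>\<^bsub>A\<^esub>"
    and step: "\<And>r a. \<lbrakk>r \<in> carrier R; a \<in> carrier A; P a\<rbrakk> \<Longrightarrow> P (\<iota> r \<oplus>\<^bsub>A\<^esub> a \<otimes>\<^bsub>A\<^esub> x)"
  shows "P a"
proof -
  have "P (\<Oplus>\<^bsub>A\<^esub>i\<in>{..n}. \<iota> (c i) \<otimes>\<^bsub>A\<^esub> x [^]\<^bsub>A\<^esub> i)" if "\<And>i. c i \<in> carrier R" for n :: nat and c
    using that
  proof (induction n arbitrary: c)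
    case 0
    then show ?case
      using step[OF 0[of 0] A.zero_closed zero] by simp
  next
    case (Suc n)
    have "(\<Oplus>\<^bsub>A\<^esub>i\<in>{..Suc n}. \<iota> (c i) \<otimes>\<^bsub>A\<^esub> x [^]\<^bsub>A\<^esub> i)
        = (\<Oplus>\<^bsub>A\<^esub>i\<in>{..n}. \<iota> (c (Suc i)) \<otimes>\<^bsub>A\<^esub> x [^]\<^bsub>A\<^esub> Suc i) \<oplus>\<^bsub>A\<^esub> \<iota> (c 0)"
      using Suc.prems by (subst A.finsum_Suc2) auto
    also have "(\<Oplus>\<^bsub>A\<^esub>i\<in>{..n}. \<iota> (c (Suc i)) \<otimes>\<^bsub>A\<^esub> x [^]\<^bsub>A\<^esub> Suc i)
        = (\<Oplus>\<^bsub>A\<^esub>i\<in>{..n}. (\<iota> (c (Suc i)) \<otimes>\<^bsub>A\<^esub> x [^]\<^bsub>A\<^esub> i) \<otimes>\<^bsub>A\<^esub> x)"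
      using Suc.prems by (intro A.finsum_cong') (auto simp: A.m_assoc)
    also have "\<dots> = (\<Oplus>\<^bsub>A\<^esub>i\<in>{..n}. \<iota> (c (Suc i)) \<otimes>\<^bsub>A\<^esub> x [^]\<^bsub>A\<^esub> i) \<otimes>\<^bsub>A\<^esub> x"
      using Suc.prems by (intro A.finsum_ldistr[symmetric]) auto
    finally have "(\<Oplus>\<^bsub>A\<^esub>i\<in>{..Suc n}. \<iota> (c i) \<otimes>\<^bsub>A\<^esub> x [^]\<^bsub>A\<^esub> i)
        = \<iota> (c 0) \<oplus>\<^bsub>A\<^esub> (\<Oplus>\<^bsub>A\<^esub>i\<in>{..n}. \<iota> (c (Suc i)) \<otimes>\<^bsub>A\<^esub> x [^]\<^bsub>A\<^esub> i) \<otimes>\<^bsub>A\<^esub> x"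
      using Suc.prems by (simp add: A.a_comm A.finsum_closed)
    then show ?case
      using step[OF Suc.prems[of 0] _ Suc.IH[of "\<lambda>i. c (Suc i)"]] Suc.prems
      by (simp add: A.finsum_closed)
  qed
  moreover obtain n where "a = (\<Oplus>\<^bsub>A\<^esub>i\<in>{..n}. \<iota> (lc a i) \<otimes>\<^bsub>A\<^esub> x [^]\<^bsub>A\<^esub> i)"
    using assms(1) by (rule left_coeffsE) blast
  ultimately show ?thesis
    using assms(1) left_coeffs_closed by metis
qed

text \<open>The coefficient of the square of \<open>x\<close> in \<open>x r x\<close> is
  \<open>\<sigma> r\<close>, and \<sigma> is injective. This permits cancelling \<open>x\<close> on
  both sides at once.\<close>

lemma x_embed_x_eq_zeroD:
  assumes "r \<in> carrier R" "x \<otimes>\<^bsub>A\<^esub> \<iota> r \<otimes>\<^bsub>A\<^esub> x = \<zero>\<^bsub>A\<^esub>"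
  shows "r = \<zero>\<^bsub>R\<^esub>"
proof -
  \<comment> \<open>Both summands of the commutation rule end in \<open>x\<close>, so
    \<open>x s\<close> has no constant term. Used at \<open>\<delta> r\<close>, this shows that
    \<open>x \<delta>(r) x\<close> adds nothing to the coefficient of \<open>x\<close> in
    \<open>x r\<close>.\<close>
  have lc0: "lc (x \<otimes>\<^bsub>A\<^esub> \<iota> s) 0 = \<zero>\<^bsub>R\<^esub>" if "s \<in> carrier R" for s
    using that by (subst commutation) (auto simp: left_coeffs_add left_coeffs_mult_x)
  have "lc (x \<otimes>\<^bsub>A\<^esub> \<iota> r) 1 = \<sigma> r"
    using assms(1)
    by (subst commutation) (auto simp: left_coeffs_add left_coeffs_mult_x left_coeffs_embed lc0)
  moreover have "lc (x \<otimes>\<^bsub>A\<^esub> \<iota> r \<otimes>\<^bsub>A\<^esub> x) 2 = lc (x \<otimes>\<^bsub>A\<^esub> \<iota> r) 1"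
    using assms(1) by (simp only: left_coeffs_mult_x A.m_closed x_closed embed_closed) simp
  ultimately have "\<sigma> r = \<zero>\<^bsub>R\<^esub>"
    using assms(2) by (simp add: left_coeffs_zero)
  then show ?thesis
    by (rule sigma_eq_zeroD[OF assms(1)])
qed

text \<open>This is where associativity of \<open>A\<close> forces more than the \<open>\<sigma>\<close>-derivation rule: it results
  from comparing \<open>x (r s)\<close> with \<open>(x r) s\<close>.\<close>

lemma delta_mult':
  assumes "r \<in> carrier R" "s \<in> carrier R"
  shows "\<delta> (r \<otimes>\<^bsub>R\<^esub> s) = r \<otimes>\<^bsub>R\<^esub> \<delta> s \<oplus>\<^bsub>R\<^esub> \<delta> r \<otimes>\<^bsub>R\<^esub> \<sigma> s"
proof -
  note [simp] = assms
  let ?t = "r \<otimes>\<^bsub>R\<^esub> \<delta> s \<oplus>\<^bsub>R\<^esub> \<delta> r \<otimes>\<^bsub>R\<^esub> \<sigma> s"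
  have "x \<otimes>\<^bsub>A\<^esub> \<iota> (r \<otimes>\<^bsub>R\<^esub> s) = (x \<otimes>\<^bsub>A\<^esub> \<iota> r) \<otimes>\<^bsub>A\<^esub> \<iota> s"
    by (simp add: embed_mult A.m_assoc)
  also have "\<dots> = \<iota> (\<sigma> r) \<otimes>\<^bsub>A\<^esub> (x \<otimes>\<^bsub>A\<^esub> \<iota> s)
      \<oplus>\<^bsub>A\<^esub> (x \<otimes>\<^bsub>A\<^esub> \<iota> (\<delta> r)) \<otimes>\<^bsub>A\<^esub> (x \<otimes>\<^bsub>A\<^esub> \<iota> s)"
    by (simp add: commutation[of r] A.m_assoc A.l_distr)
  also have "\<dots> = \<iota> (\<sigma> r) \<otimes>\<^bsub>A\<^esub> \<iota> (\<sigma> s) \<otimes>\<^bsub>A\<^esub> x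
      \<oplus>\<^bsub>A\<^esub> ((\<iota> (\<sigma> r) \<otimes>\<^bsub>A\<^esub> x \<oplus>\<^bsub>A\<^esub> x \<otimes>\<^bsub>A\<^esub> \<iota> (\<delta> r) \<otimes>\<^bsub>A\<^esub> x) \<otimes>\<^bsub>A\<^esub> \<iota> (\<delta> s) \<otimes>\<^bsub>A\<^esub> x
      \<oplus>\<^bsub>A\<^esub> x \<otimes>\<^bsub>A\<^esub> \<iota> (\<delta> r) \<otimes>\<^bsub>A\<^esub> \<iota> (\<sigma> s) \<otimes>\<^bsub>A\<^esub> x)"
    by (simp only: commutation[of s, OF assms(2)])
      (simp add: A.m_assoc A.l_distr A.r_distr A.a_ac)
  \<comment> \<open>The rule for \<open>x r\<close> is now read backwards. Folding these terms
    avoids an ever longer expansion and leaves a single product of the form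
    \<open>x t x\<close>.\<close>
  also have "\<iota> (\<sigma> r) \<otimes>\<^bsub>A\<^esub> x \<oplus>\<^bsub>A\<^esub> x \<otimes>\<^bsub>A\<^esub> \<iota> (\<delta> r) \<otimes>\<^bsub>A\<^esub> x = x \<otimes>\<^bsub>A\<^esub> \<iota> r"
    by (simp add: commutation)
  also have "x \<otimes>\<^bsub>A\<^esub> \<iota> r \<otimes>\<^bsub>A\<^esub> \<iota> (\<delta> s) \<otimes>\<^bsub>A\<^esub> x
      \<oplus>\<^bsub>A\<^esub> x \<otimes>\<^bsub>A\<^esub> \<iota> (\<delta> r) \<otimes>\<^bsub>A\<^esub> \<iota> (\<sigma> s) \<otimes>\<^bsub>A\<^esub> x = x \<otimes>\<^bsub>A\<^esub> \<iota> ?t \<otimes>\<^bsub>A\<^esub> x"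
    by (simp add: embed_add embed_mult A.m_assoc A.l_distr A.r_distr)
  also have "\<iota> (\<sigma> r) \<otimes>\<^bsub>A\<^esub> \<iota> (\<sigma> s) = \<iota> (\<sigma> (r \<otimes>\<^bsub>R\<^esub> s))"
    by (simp add: embed_mult ring_hom_mult[OF sigma_hom])
  finally have "x \<otimes>\<^bsub>A\<^esub> \<iota> (\<delta> (r \<otimes>\<^bsub>R\<^esub> s)) \<otimes>\<^bsub>A\<^esub> x = x \<otimes>\<^bsub>A\<^esub> \<iota> ?t \<otimes>\<^bsub>A\<^esub> x"
    by (simp add: commutation[of "r \<otimes>\<^bsub>R\<^esub> s"])
  \<comment> \<open>Equality of two products \<open>x u x\<close> and \<open>x v x\<close> becomes
    the vanishing of one product at the difference, the form that \<open>x_embed_x_eq_zeroD\<close>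
    accepts.\<close>
  moreover have "x \<otimes>\<^bsub>A\<^esub> \<iota> (u \<ominus>\<^bsub>R\<^esub> v) \<otimes>\<^bsub>A\<^esub> x
      = x \<otimes>\<^bsub>A\<^esub> \<iota> u \<otimes>\<^bsub>A\<^esub> x \<ominus>\<^bsub>A\<^esub> x \<otimes>\<^bsub>A\<^esub> \<iota> v \<otimes>\<^bsub>A\<^esub> x"
    if [simp]: "u \<in> carrier R" "v \<in> carrier R" for u v
  proof -
    have "x \<otimes>\<^bsub>A\<^esub> \<iota> u \<otimes>\<^bsub>A\<^esub> x = x \<otimes>\<^bsub>A\<^esub> \<iota> ((u \<ominus>\<^bsub>R\<^esub> v) \<oplus>\<^bsub>R\<^esub> v) \<otimes>\<^bsub>A\<^esub> x"
      by (simp add: R.minus_eq R.a_assoc R.l_neg)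
    also have "\<dots> = x \<otimes>\<^bsub>A\<^esub> \<iota> (u \<ominus>\<^bsub>R\<^esub> v) \<otimes>\<^bsub>A\<^esub> x \<oplus>\<^bsub>A\<^esub> x \<otimes>\<^bsub>A\<^esub> \<iota> v \<otimes>\<^bsub>A\<^esub> x"
      by (simp add: embed_add A.l_distr A.r_distr del: R.minus_eq)
    finally show ?thesis
      by (simp add: A.minus_eq A.a_assoc A.r_neg)
  qed
  ultimately have "\<delta> (r \<otimes>\<^bsub>R\<^esub> s) \<ominus>\<^bsub>R\<^esub> ?t = \<zero>\<^bsub>R\<^esub>"
    by (intro x_embed_x_eq_zeroD) (simp_all add: A.minus_eq A.r_neg)
  then show ?thesis
    by (simp add: R.r_right_minus_eq)
qed

section \<open>The inverse automorphism and the word sums \<open>f\<^sub>k\<^sup>i\<close>\<close>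

abbreviation "s' \<equiv> sigma' R \<sigma>"
abbreviation "d' \<equiv> delta' R \<sigma> \<delta>"
abbreviation "ws \<equiv> word_sum R \<sigma> \<delta>"

lemma sigma'_closed [simp, intro]: "r \<in> carrier R \<Longrightarrow> s' r \<in> carrier R"
  using sigma_bij unfolding sigma'_def by (metis bij_betw_apply bij_betw_inv_into)

lemma sigma_sigma' [simp]: "r \<in> carrier R \<Longrightarrow> \<sigma> (s' r) = r"
  using sigma_bij unfolding sigma'_def by (rule bij_betw_inv_into_right)

lemma sigma'_sigma [simp]: "r \<in> carrier R \<Longrightarrow> s' (\<sigma> r) = r"
  using sigma_bij unfolding sigma'_def by (rule bij_betw_inv_into_left)

lemma sigma'_add:
  assumes "r \<in> carrier R" "s \<in> carrier R"
  shows "s' (r \<oplus>\<^bsub>R\<^esub> s) = s' r \<oplus>\<^bsub>R\<^esub> s' s"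
  using sigma'_sigma[of "s' r \<oplus>\<^bsub>R\<^esub> s' s"] ring_hom_add[OF sigma_hom, of "s' r" "s' s"] assms
  by simp

lemma sigma'_mult:
  assumes "r \<in> carrier R" "s \<in> carrier R"
  shows "s' (r \<otimes>\<^bsub>R\<^esub> s) = s' r \<otimes>\<^bsub>R\<^esub> s' s"
  using sigma'_sigma[of "s' r \<otimes>\<^bsub>R\<^esub> s' s"] ring_hom_mult[OF sigma_hom, of "s' r" "s' s"] assms
  by simp

lemma sigma'_one [simp]: "s' \<one>\<^bsub>R\<^esub> = \<one>\<^bsub>R\<^esub>"
  using sigma'_sigma[of "\<one>\<^bsub>R\<^esub>"] ring_hom_one[OF sigma_hom] by simp

lemma delta'_closed [simp, intro]: "r \<in> carrier R \<Longrightarrow> d' r \<in> carrier R"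
  by (simp add: delta'_def)

lemma delta'_add:
  "\<lbrakk>r \<in> carrier R; s \<in> carrier R\<rbrakk> \<Longrightarrow> d' (r \<oplus>\<^bsub>R\<^esub> s) = d' r \<oplus>\<^bsub>R\<^esub> d' s"
  by (simp add: delta'_def sigma'_add delta_add R.minus_add)

lemma delta'_one [simp]: "d' \<one>\<^bsub>R\<^esub> = \<zero>\<^bsub>R\<^esub>"
  by (simp add: delta'_def)

lemma delta'_sigma: "r \<in> carrier R \<Longrightarrow> d' (\<sigma> r) = \<ominus>\<^bsub>R\<^esub> \<delta> r"
  by (simp add: delta'_def)

text \<open>The rule \<open>delta_mult'\<close>, taken at \<open>s' r\<close> and
  \<open>s' s\<close>, has \<open>\<sigma> (s' s) = s\<close> in its second summand. Hence
  \<open>d'\<close> is an \<open>s'\<close>-derivation, which is what the product formula for word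
  sums needs.\<close>

lemma delta'_mult:
  "\<lbrakk>r \<in> carrier R; s \<in> carrier R\<rbrakk>
    \<Longrightarrow> d' (r \<otimes>\<^bsub>R\<^esub> s) = s' r \<otimes>\<^bsub>R\<^esub> d' s \<oplus>\<^bsub>R\<^esub> d' r \<otimes>\<^bsub>R\<^esub> s"
  by (simp add: delta'_def sigma'_mult delta_mult' R.minus_add R.l_minus R.r_minus)

lemma word_map_closed [simp, intro]: "r \<in> carrier R \<Longrightarrow> word_map R \<sigma> \<delta> w r \<in> carrier R"
  by (induction w) (auto simp: word_map_def)

text \<open>\<open>foldr\<close> applies the last letter first. Splitting words at their end
  therefore lets the removed letter act on the argument and leaves a word sum of smaller length; the
  recursions for \<open>ws\<close> below come from this.\<close>

lemma word_map_snoc: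
  "word_map R \<sigma> \<delta> (w @ [b]) r = word_map R \<sigma> \<delta> w (if b then s' r else d' r)"
  by (simp add: word_map_def)

lemma finite_words: "finite {w :: bool list. length w = k \<and> P w}"
  by (rule finite_subset[OF _ finite_lists_length_eq[of UNIV k]]) auto

lemma word_sum_closed [simp, intro]: "r \<in> carrier R \<Longrightarrow> ws k i r \<in> carrier R"
  unfolding word_sum_def by (auto intro: R.finsum_closed)

lemma word_sum_0_0 [simp]: "r \<in> carrier R \<Longrightarrow> ws 0 0 r = r"
proof -
  assume r: "r \<in> carrier R"
  have "{w :: bool list. length w = 0 \<and> count_list w True = 0} = {[]}"
    by auto
  with r show ?thesis
    by (simp add: word_sum_def word_map_def)
qed

lemma word_sum_gt [simp]: "k < i \<Longrightarrow> ws k i r = \<zero>\<^bsub>R\<^esub>"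
proof -
  assume "k < i"
  then have "{w. length w = k \<and> count_list w True = i} = {}"
    using count_le_length[of _ True] by (auto simp: not_le[symmetric])
  then show ?thesis
    by (simp only: word_sum_def R.finsum_empty)
qed

lemma finsum_words_snoc:
  assumes "r \<in> carrier R"
  shows "(\<Oplus>\<^bsub>R\<^esub>w\<in>(\<lambda>w. w @ [b]) ` {w. length w = k \<and> count_list w True = i}.
      word_map R \<sigma> \<delta> w r) = ws k i (if b then s' r else d' r)"
  using assms unfolding word_sum_def
  by (subst R.finsum_reindex) (auto simp: word_map_snoc inj_on_def intro!: R.finsum_cong')

lemma word_sum_Suc_0:
  assumes "r \<in> carrier R"
  shows "ws (Suc k) 0 r = ws k 0 (d' r)"
proof -
  have "{w. length w = Suc k \<and> count_list w True = 0}
      = (\<lambda>w. w @ [False]) ` {w. length w = k \<and> count_list w True = 0}"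
    by (auto simp: image_iff length_Suc_conv_rev split: if_splits)
  then show ?thesis
    using finsum_words_snoc[OF assms, of False k 0] by (simp add: word_sum_def[of _ _ _ "Suc k"])
qed

lemma word_sum_Suc_Suc:
  assumes "r \<in> carrier R"
  shows "ws (Suc k) (Suc i) r = ws k i (s' r) \<oplus>\<^bsub>R\<^esub> ws k (Suc i) (d' r)"
proof -
  have "{w. length w = Suc k \<and> count_list w True = Suc i}
      = (\<lambda>w. w @ [True]) ` {w. length w = k \<and> count_list w True = i}
      \<union> (\<lambda>w. w @ [False]) ` {w. length w = k \<and> count_list w True = Suc i}"
    by (auto simp: image_iff length_Suc_conv_rev split: if_splits)
  then have "ws (Suc k) (Suc i) r =
      (\<Oplus>\<^bsub>R\<^esub>w\<in>(\<lambda>w. w @ [True]) ` {w. length w = k \<and> count_list w True = i}. word_map R \<sigma> \<delta> w r)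
      \<oplus>\<^bsub>R\<^esub> (\<Oplus>\<^bsub>R\<^esub>w\<in>(\<lambda>w. w @ [False]) ` {w. length w = k \<and> count_list w True = Suc i}.
        word_map R \<sigma> \<delta> w r)"
    using assms unfolding word_sum_def
    by (simp only:) (intro R.finsum_Un_disjoint; auto simp: finite_words)
  also have "\<dots> = ws k i (s' r) \<oplus>\<^bsub>R\<^esub> ws k (Suc i) (d' r)"
    using finsum_words_snoc[OF assms] by simp
  finally show ?thesis .
qed

lemma word_sum_add:
  "\<lbrakk>r \<in> carrier R; s \<in> carrier R\<rbrakk> \<Longrightarrow> ws k i (r \<oplus>\<^bsub>R\<^esub> s) = ws k i r \<oplus>\<^bsub>R\<^esub> ws k i s"
proof (induction k arbitrary: i r s)
  case 0
  then show ?case by (cases i) auto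
next
  case (Suc k)
  then show ?case
    by (cases i) (auto simp: word_sum_Suc_0 word_sum_Suc_Suc sigma'_add delta'_add R.a_ac)
qed

lemma word_sum_zero [simp]: "ws k i \<zero>\<^bsub>R\<^esub> = \<zero>\<^bsub>R\<^esub>"
  using word_sum_add[of "\<zero>\<^bsub>R\<^esub>" "\<zero>\<^bsub>R\<^esub>" k i] by (simp add: R.add.r_cancel_one')

lemma word_sum_minus: "r \<in> carrier R \<Longrightarrow> ws k i (\<ominus>\<^bsub>R\<^esub> r) = \<ominus>\<^bsub>R\<^esub> ws k i r"
  using word_sum_add[of "\<ominus>\<^bsub>R\<^esub> r" r k i] by (simp add: R.l_neg R.minus_equality)

text \<open>\<open>s'\<close> fixes one and \<open>d'\<close> annihilates it, so only the word
  without any letter \<open>d'\<close> contributes.\<close>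

lemma word_sum_one: "ws k i \<one>\<^bsub>R\<^esub> = (if k = i then \<one>\<^bsub>R\<^esub> else \<zero>\<^bsub>R\<^esub>)"
proof (induction k arbitrary: i)
  case 0
  then show ?case by (cases i) auto
next
  case (Suc k)
  then show ?case
    by (cases i) (auto simp: word_sum_Suc_0 word_sum_Suc_Suc)
qed

text \<open>Words ending in \<open>d'\<close> contribute \<open>ws k (Suc i)\<close> at
  \<open>d' (\<sigma> r)\<close>, the negative of \<open>\<delta> r\<close>, and the added term
  cancels them. This is the commutation rule on the level of word sums.\<close>

lemma word_sum_Suc_Suc_sigma:
  "r \<in> carrier R \<Longrightarrow> ws (Suc k) (Suc i) (\<sigma> r) \<oplus>\<^bsub>R\<^esub> ws k (Suc i) (\<delta> r) = ws k i r"
  by (simp add: word_sum_Suc_Suc delta'_sigma word_sum_minus R.a_assoc R.l_neg)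

text \<open>The triangular matrices with entries \<open>ws k j r\<close> multiply as the ring
  elements do. The induction removes the innermost letter, using that \<open>s'\<close> is
  multiplicative and \<open>d'\<close> is an \<open>s'\<close>-derivation. A bound \<open>n\<close>
  beyond \<open>k\<close> adds only zero terms, and it gives \<open>scale_scale\<close> one range
  for all \<open>k\<close>.\<close>

lemma word_sum_mult:
  assumes "k \<le> n" "r \<in> carrier R" "s \<in> carrier R"
  shows "ws k i (r \<otimes>\<^bsub>R\<^esub> s) = (\<Oplus>\<^bsub>R\<^esub>j\<in>{..n}. ws k j r \<otimes>\<^bsub>R\<^esub> ws j i s)"
  using assms
proof (induction k arbitrary: n i r s)
  case 0
  have "(\<Oplus>\<^bsub>R\<^esub>j\<in>{..n}. ws 0 j r \<otimes>\<^bsub>R\<^esub> ws j i s) = (\<Oplus>\<^bsub>R\<^esub>j\<in>{0}. ws 0 j r \<otimes>\<^bsub>R\<^esub> ws j i s)"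
    using 0 by (intro R.add.finprod_mono_neutral_cong_right) auto
  then show ?case
    using 0 by (cases i) auto
next
  case (Suc k)
  obtain m where n: "n = Suc m" and "k \<le> m"
    using Suc.prems(1) by (cases n) auto
  note IH = Suc.IH[OF \<open>k \<le> m\<close>]
  note [simp] = Suc.prems(2,3)
  \<comment> \<open>The hypothesis at the larger bound \<open>Suc m\<close>, with the term at zero
    split off, matches the index shift that the recursion produces.\<close>
  have IH': "ws k i (u \<otimes>\<^bsub>R\<^esub> v) = (\<Oplus>\<^bsub>R\<^esub>j\<in>{..m}. ws k (Suc j) u \<otimes>\<^bsub>R\<^esub> ws (Suc j) i v)
      \<oplus>\<^bsub>R\<^esub> ws k 0 u \<otimes>\<^bsub>R\<^esub> ws 0 i v" if "u \<in> carrier R" "v \<in> carrier R" for u v i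
    using Suc.IH[of "Suc m" u v i] \<open>k \<le> m\<close> that by (simp only: le_SucI) (subst R.finsum_Suc2, auto)
  \<comment> \<open>Recursion in the left factor. The half with \<open>d' r\<close>, together with
    the term at zero, is the sum in \<open>IH'\<close>; in the half with \<open>s' r\<close> the
    inner indices of the two factors now differ by one.\<close>
  have *: "(\<Oplus>\<^bsub>R\<^esub>j\<in>{..n}. ws (Suc k) j r \<otimes>\<^bsub>R\<^esub> ws j i s)
      = (\<Oplus>\<^bsub>R\<^esub>j\<in>{..m}. ws k j (s' r) \<otimes>\<^bsub>R\<^esub> ws (Suc j) i s) \<oplus>\<^bsub>R\<^esub> ws k i (d' r \<otimes>\<^bsub>R\<^esub> s)"
  proof -
    have "(\<Oplus>\<^bsub>R\<^esub>j\<in>{..n}. ws (Suc k) j r \<otimes>\<^bsub>R\<^esub> ws j i s)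
        = (\<Oplus>\<^bsub>R\<^esub>j\<in>{..m}. ws (Suc k) (Suc j) r \<otimes>\<^bsub>R\<^esub> ws (Suc j) i s)
          \<oplus>\<^bsub>R\<^esub> ws (Suc k) 0 r \<otimes>\<^bsub>R\<^esub> ws 0 i s"
      unfolding n by (subst R.finsum_Suc2) auto
    also have "(\<Oplus>\<^bsub>R\<^esub>j\<in>{..m}. ws (Suc k) (Suc j) r \<otimes>\<^bsub>R\<^esub> ws (Suc j) i s)
        = (\<Oplus>\<^bsub>R\<^esub>j\<in>{..m}. ws k j (s' r) \<otimes>\<^bsub>R\<^esub> ws (Suc j) i s
            \<oplus>\<^bsub>R\<^esub> ws k (Suc j) (d' r) \<otimes>\<^bsub>R\<^esub> ws (Suc j) i s)"
      by (intro R.finsum_cong') (auto simp: word_sum_Suc_Suc R.l_distr)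
    also have "\<dots> = (\<Oplus>\<^bsub>R\<^esub>j\<in>{..m}. ws k j (s' r) \<otimes>\<^bsub>R\<^esub> ws (Suc j) i s)
        \<oplus>\<^bsub>R\<^esub> (\<Oplus>\<^bsub>R\<^esub>j\<in>{..m}. ws k (Suc j) (d' r) \<otimes>\<^bsub>R\<^esub> ws (Suc j) i s)"
      by (intro R.finsum_addf) auto
    finally show ?thesis
      by (simp add: IH' word_sum_Suc_0 R.a_assoc R.finsum_closed)
  qed
  \<comment> \<open>Recursion in the right factor lowers \<open>Suc j\<close> to \<open>j\<close>
    and realigns the indices. For \<open>i = 0\<close> only the branch with \<open>d'\<close>
    exists.\<close>
  show ?case
  proof (cases i)
    case 0
    have "(\<Oplus>\<^bsub>R\<^esub>j\<in>{..m}. ws k j (s' r) \<otimes>\<^bsub>R\<^esub> ws (Suc j) i s)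
        = (\<Oplus>\<^bsub>R\<^esub>j\<in>{..m}. ws k j (s' r) \<otimes>\<^bsub>R\<^esub> ws j i (d' s))"
      by (intro R.finsum_cong') (auto simp: word_sum_Suc_0 0)
    also have "\<dots> = ws k i (s' r \<otimes>\<^bsub>R\<^esub> d' s)"
      by (simp add: IH)
    finally show ?thesis
      unfolding * by (simp add: 0 word_sum_Suc_0 delta'_mult word_sum_add)
  next
    case (Suc i')
    have "(\<Oplus>\<^bsub>R\<^esub>j\<in>{..m}. ws k j (s' r) \<otimes>\<^bsub>R\<^esub> ws (Suc j) i s)
        = (\<Oplus>\<^bsub>R\<^esub>j\<in>{..m}. ws k j (s' r) \<otimes>\<^bsub>R\<^esub> ws j i' (s' s)
            \<oplus>\<^bsub>R\<^esub> ws k j (s' r) \<otimes>\<^bsub>R\<^esub> ws j i (d' s))"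
      by (intro R.finsum_cong') (auto simp: word_sum_Suc_Suc Suc R.r_distr)
    also have "\<dots> = ws k i' (s' r \<otimes>\<^bsub>R\<^esub> s' s) \<oplus>\<^bsub>R\<^esub> ws k i (s' r \<otimes>\<^bsub>R\<^esub> d' s)"
      by (subst R.finsum_addf) (auto simp: IH)
    finally show ?thesis
      unfolding * by (simp add: Suc word_sum_Suc_Suc delta'_mult sigma'_mult word_sum_add R.a_assoc)
  qed
qed

end

section \<open>Inverse polynomials\<close>

context right_module
begin

lemma rsmult_zero_left [simp]: "r \<in> carrier R \<Longrightarrow> \<zero>\<^bsub>M\<^esub> \<bullet>\<^bsub>M\<^esub> r = \<zero>\<^bsub>M\<^esub>"
  using rsmult_l_distr[of "\<zero>\<^bsub>M\<^esub>" "\<zero>\<^bsub>M\<^esub>" r] rsmult_closed[of "\<zero>\<^bsub>M\<^esub>" r]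
  by (simp add: M.add.r_cancel_one')

lemma rsmult_zero_right [simp]: "m \<in> carrier M \<Longrightarrow> m \<bullet>\<^bsub>M\<^esub> \<zero>\<^bsub>R\<^esub> = \<zero>\<^bsub>M\<^esub>"
  using rsmult_r_distr[of m "\<zero>\<^bsub>R\<^esub>" "\<zero>\<^bsub>R\<^esub>"] rsmult_closed[of m "\<zero>\<^bsub>R\<^esub>"]
  by (simp add: M.add.r_cancel_one')

lemma rsmult_finsum_left:
  assumes "finite S" "f \<in> S \<rightarrow> carrier M" "r \<in> carrier R"
  shows "(\<Oplus>\<^bsub>M\<^esub>i\<in>S. f i) \<bullet>\<^bsub>M\<^esub> r = (\<Oplus>\<^bsub>M\<^esub>i\<in>S. f i \<bullet>\<^bsub>M\<^esub> r)"
  using assms(1,2)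
proof (induction S)
  case (insert s S)
  then show ?case
    using assms(3)
    by (simp add: Pi_iff rsmult_closed rsmult_l_distr)
qed (use assms(3) in simp)

lemma rsmult_finsum_right:
  assumes "finite S" "f \<in> S \<rightarrow> carrier R" "m \<in> carrier M"
  shows "m \<bullet>\<^bsub>M\<^esub> (\<Oplus>\<^bsub>R\<^esub>i\<in>S. f i) = (\<Oplus>\<^bsub>M\<^esub>i\<in>S. m \<bullet>\<^bsub>M\<^esub> f i)"
  using assms(1,2)
proof (induction S)
  case (insert s S)
  then show ?case
    using assms(3)
    by (simp add: Pi_iff rsmult_closed rsmult_r_distr)
qed (use assms(3) in simp)

end

lemma (in right_submodule) rsub_finsum_closed:
  "\<lbrakk>finite S; f \<in> S \<rightarrow> N\<rbrakk> \<Longrightarrow> (\<Oplus>\<^bsub>M\<^esub>i\<in>S. f i) \<in> N"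
proof (induction S rule: finite_induct)
  case (insert s S)
  then show ?case
    using a_subset by (subst M.finsum_insert) (auto simp: Pi_iff)
qed simp

locale inv_poly_setting = skew_Ore_autom R A \<sigma> \<delta> \<iota> x + right_module R M
  for R :: "('r, 'b) ring_scheme" (structure)
    and A :: "('a, 'd) ring_scheme" (structure)
    and \<sigma> \<delta> \<iota> x
    and M :: "('m, 'r, 'c) right_module_scheme" (structure)
begin

declare rsmult_closed [simp, intro]

section \<open>The action of \<open>R\<close> on inverse polynomials\<close>

abbreviation "P \<equiv> inv_poly_module R \<sigma> \<delta> A \<iota> x M"
abbreviation "scale \<equiv> inv_poly_scale R \<sigma> \<delta> M"
abbreviation "sh p \<equiv> inv_poly_shift p 1"

text \<open>The indices \<open>k < i\<close> may be included because \<open>ws k i\<close> vanishes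
  there. The range no longer depends on \<open>i\<close>, so sums can be exchanged.\<close>

lemma scale_eq:
  assumes "p \<in> coeff_seqs M" "\<And>i. i > n \<Longrightarrow> p i = \<zero>\<^bsub>M\<^esub>" "r \<in> carrier R"
  shows "scale p r i = (\<Oplus>\<^bsub>M\<^esub>k\<in>{..n}. p k \<bullet>\<^bsub>M\<^esub> ws k i r)"
  unfolding inv_poly_scale_def using assms(2,3) coeff_seqs_closed[OF assms(1)]
  by (intro M.add.finprod_mono_neutral_cong_left) (auto simp: not_le not_less[symmetric])

text \<open>The action of \<open>R\<close> does not raise the degree: a word of length
  \<open>k \<le> n\<close> cannot contain more than \<open>n\<close> letters.\<close>

lemma scale_closed [simp, intro]:
  assumes "p \<in> coeff_seqs M" "r \<in> carrier R"
  shows "scale p r \<in> coeff_seqs M"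
proof -
  obtain n where n: "\<And>i. p i \<in> carrier M" "\<And>i. i > n \<Longrightarrow> p i = \<zero>\<^bsub>M\<^esub>"
    using assms(1) by (rule coeff_seqsE) blast
  show ?thesis
    by (rule coeff_seqsI[where n = n])
      (auto simp: scale_eq[OF assms(1) n(2) assms(2)] n assms
        intro!: M.finsum_closed M.finsum_zeroI)
qed

lemma scale_add_left:
  assumes "p \<in> coeff_seqs M" "q \<in> coeff_seqs M" "r \<in> carrier R"
  shows "scale (\<lambda>i. p i \<oplus>\<^bsub>M\<^esub> q i) r = (\<lambda>i. scale p r i \<oplus>\<^bsub>M\<^esub> scale q r i)"
proof
  fix i
  obtain n where n: "\<And>i. p i \<in> carrier M" "\<And>i. i > n \<Longrightarrow> p i = \<zero>\<^bsub>M\<^esub>"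
    using assms(1) by (rule coeff_seqsE) blast
  obtain m where m: "\<And>i. q i \<in> carrier M" "\<And>i. i > m \<Longrightarrow> q i = \<zero>\<^bsub>M\<^esub>"
    using assms(2) by (rule coeff_seqsE) blast
  let ?k = "max n m"
  have "scale (\<lambda>i. p i \<oplus>\<^bsub>M\<^esub> q i) r i = (\<Oplus>\<^bsub>M\<^esub>k\<in>{..?k}. (p k \<oplus>\<^bsub>M\<^esub> q k) \<bullet>\<^bsub>M\<^esub> ws k i r)"
    using assms n m by (intro scale_eq M.coeff_seqs_add) auto
  also have "\<dots> = (\<Oplus>\<^bsub>M\<^esub>k\<in>{..?k}. p k \<bullet>\<^bsub>M\<^esub> ws k i r \<oplus>\<^bsub>M\<^esub> q k \<bullet>\<^bsub>M\<^esub> ws k i r)"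
    using assms n m by (intro M.finsum_cong') (auto simp: rsmult_l_distr)
  also have "\<dots> = scale p r i \<oplus>\<^bsub>M\<^esub> scale q r i"
    using assms n m by (subst M.finsum_addf) (auto simp: scale_eq[where n = ?k])
  finally show "scale (\<lambda>i. p i \<oplus>\<^bsub>M\<^esub> q i) r i = scale p r i \<oplus>\<^bsub>M\<^esub> scale q r i" .
qed

lemma scale_add_right:
  assumes "p \<in> coeff_seqs M" "r \<in> carrier R" "s \<in> carrier R"
  shows "scale p (r \<oplus>\<^bsub>R\<^esub> s) = (\<lambda>i. scale p r i \<oplus>\<^bsub>M\<^esub> scale p s i)"
proof
  fix i
  obtain n where n: "\<And>i. p i \<in> carrier M" "\<And>i. i > n \<Longrightarrow> p i = \<zero>\<^bsub>M\<^esub>"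
    using assms(1) by (rule coeff_seqsE) blast
  have "(\<Oplus>\<^bsub>M\<^esub>k\<in>{..n}. p k \<bullet>\<^bsub>M\<^esub> ws k i (r \<oplus>\<^bsub>R\<^esub> s))
      = (\<Oplus>\<^bsub>M\<^esub>k\<in>{..n}. p k \<bullet>\<^bsub>M\<^esub> ws k i r \<oplus>\<^bsub>M\<^esub> p k \<bullet>\<^bsub>M\<^esub> ws k i s)"
    using assms n by (intro M.finsum_cong') (auto simp: word_sum_add rsmult_r_distr)
  also have "\<dots> = (\<Oplus>\<^bsub>M\<^esub>k\<in>{..n}. p k \<bullet>\<^bsub>M\<^esub> ws k i r) \<oplus>\<^bsub>M\<^esub> (\<Oplus>\<^bsub>M\<^esub>k\<in>{..n}. p k \<bullet>\<^bsub>M\<^esub> ws k i s)"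
    using assms n by (intro M.finsum_addf) auto
  finally show "scale p (r \<oplus>\<^bsub>R\<^esub> s) i = scale p r i \<oplus>\<^bsub>M\<^esub> scale p s i"
    using assms n by (simp add: scale_eq[where n = n])
qed

lemma scale_zero_right [simp]:
  assumes "p \<in> coeff_seqs M"
  shows "scale p \<zero>\<^bsub>R\<^esub> = (\<lambda>i. \<zero>\<^bsub>M\<^esub>)"
  unfolding inv_poly_scale_def using coeff_seqs_closed[OF assms]
  by (intro ext M.finsum_zeroI) simp

lemma scale_one:
  assumes "p \<in> coeff_seqs M"
  shows "scale p \<one>\<^bsub>R\<^esub> = p"
proof
  fix i
  obtain n where n: "\<And>i. p i \<in> carrier M" "\<And>i. i > n \<Longrightarrow> p i = \<zero>\<^bsub>M\<^esub>"
    using assms(1) by (rule coeff_seqsE) blast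
  \<comment> \<open>The bound \<open>max n i\<close> keeps the index \<open>i\<close> in the range
    even beyond the degree of \<open>p\<close>.\<close>
  have "scale p \<one>\<^bsub>R\<^esub> i = (\<Oplus>\<^bsub>M\<^esub>k\<in>{..max n i}. p k \<bullet>\<^bsub>M\<^esub> ws k i \<one>\<^bsub>R\<^esub>)"
    using assms n by (intro scale_eq) auto
  also have "\<dots> = (\<Oplus>\<^bsub>M\<^esub>k\<in>{..max n i}. if k = i then p k else \<zero>\<^bsub>M\<^esub>)"
    using n by (intro M.finsum_cong') (auto simp: word_sum_one rsmult_one)
  also have "\<dots> = p i"
    using n by (intro M.add.finprod_singleton_swap) auto
  finally show "scale p \<one>\<^bsub>R\<^esub> i = p i" .
qed

text \<open>After exchanging the two sums, the inner one is the matrix product of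
  \<open>word_sum_mult\<close>. Both can run up to \<open>n\<close> because scaling does not raise
  the degree.\<close>

lemma scale_scale:
  assumes "p \<in> coeff_seqs M" "r \<in> carrier R" "s \<in> carrier R"
  shows "scale (scale p r) s = scale p (r \<otimes>\<^bsub>R\<^esub> s)"
proof
  fix i
  obtain n where n: "\<And>i. p i \<in> carrier M" "\<And>i. i > n \<Longrightarrow> p i = \<zero>\<^bsub>M\<^esub>"
    using assms(1) by (rule coeff_seqsE) blast
  have "scale p r j = \<zero>\<^bsub>M\<^esub>" if "j > n" for j
    using that assms n by (auto simp: scale_eq[where n = n] intro!: M.finsum_zeroI)
  then have "scale (scale p r) s i
      = (\<Oplus>\<^bsub>M\<^esub>j\<in>{..n}. (\<Oplus>\<^bsub>M\<^esub>k\<in>{..n}. p k \<bullet>\<^bsub>M\<^esub> ws k j r) \<bullet>\<^bsub>M\<^esub> ws j i s)"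
    using assms n by (simp add: scale_eq[where n = n])
  also have "\<dots> = (\<Oplus>\<^bsub>M\<^esub>j\<in>{..n}. \<Oplus>\<^bsub>M\<^esub>k\<in>{..n}. p k \<bullet>\<^bsub>M\<^esub> (ws k j r \<otimes>\<^bsub>R\<^esub> ws j i s))"
    using assms n
    by (intro M.finsum_cong')
      (auto simp: rsmult_finsum_left rsmult_assoc intro!: M.finsum_closed M.finsum_cong')
  also have "\<dots> = (\<Oplus>\<^bsub>M\<^esub>k\<in>{..n}. \<Oplus>\<^bsub>M\<^esub>j\<in>{..n}. p k \<bullet>\<^bsub>M\<^esub> (ws k j r \<otimes>\<^bsub>R\<^esub> ws j i s))"
    using assms n by (intro M.finsum_swap) auto
  also have "\<dots> = (\<Oplus>\<^bsub>M\<^esub>k\<in>{..n}. p k \<bullet>\<^bsub>M\<^esub> ws k i (r \<otimes>\<^bsub>R\<^esub> s))"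
    using assms n
    by (intro M.finsum_cong') (auto simp: rsmult_finsum_right word_sum_mult[where n = n])
  also have "\<dots> = scale p (r \<otimes>\<^bsub>R\<^esub> s) i"
    using assms n by (simp add: scale_eq[where n = n])
  finally show "scale (scale p r) s i = scale p (r \<otimes>\<^bsub>R\<^esub> s) i" .
qed

text \<open>The module counterpart of \<open>x r = \<sigma>(r) x + x \<delta>(r) x\<close>, with the
  shift in the role of \<open>x\<close>. Coefficientwise it is
  \<open>word_sum_Suc_Suc_sigma\<close>.\<close>

lemma scale_shift:
  assumes "p \<in> coeff_seqs M" "r \<in> carrier R"
  shows "scale (sh p) r = (\<lambda>i. sh (scale p (\<sigma> r)) i \<oplus>\<^bsub>M\<^esub> sh (scale (sh p) (\<delta> r)) i)"
proof
  fix i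
  obtain n where n: "\<And>i. p i \<in> carrier M" "\<And>i. i > n \<Longrightarrow> p i = \<zero>\<^bsub>M\<^esub>"
    using assms(1) by (rule coeff_seqsE) blast
  have sh: "sh p \<in> coeff_seqs M" "sh p j = p (Suc j)" "j > n \<Longrightarrow> p (Suc j) = \<zero>\<^bsub>M\<^esub>" for j
    using assms n inv_poly_shift_closed[of p M 1] by (auto simp: inv_poly_shift_def)
  have "sh (scale p (\<sigma> r)) i = (\<Oplus>\<^bsub>M\<^esub>k\<in>{..Suc n}. p k \<bullet>\<^bsub>M\<^esub> ws k (Suc i) (\<sigma> r))"
    using assms n by (simp add: inv_poly_shift_def scale_eq[where n = "Suc n"])
  \<comment> \<open>The term at \<open>k = 0\<close> drops out since \<open>ws 0 (Suc i)\<close> is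
    zero. Starting from the bound \<open>Suc n\<close>, the reindexed sum has the same range as the
    sums for \<open>sh p\<close>.\<close>
  also have "\<dots> = (\<Oplus>\<^bsub>M\<^esub>k\<in>{..n}. p (Suc k) \<bullet>\<^bsub>M\<^esub> ws (Suc k) (Suc i) (\<sigma> r))"
    using assms n by (subst M.finsum_Suc2) (auto intro!: M.finsum_closed)
  finally have 1: "sh (scale p (\<sigma> r)) i = (\<Oplus>\<^bsub>M\<^esub>k\<in>{..n}. p (Suc k) \<bullet>\<^bsub>M\<^esub> ws (Suc k) (Suc i) (\<sigma> r))" .
  have 2: "scale (sh p) s i = (\<Oplus>\<^bsub>M\<^esub>k\<in>{..n}. p (Suc k) \<bullet>\<^bsub>M\<^esub> ws k i s)" if "s \<in> carrier R" for s i
    using that sh by (subst scale_eq[where n = n]) auto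
  have 3: "sh (scale (sh p) (\<delta> r)) i = (\<Oplus>\<^bsub>M\<^esub>k\<in>{..n}. p (Suc k) \<bullet>\<^bsub>M\<^esub> ws k (Suc i) (\<delta> r))"
    using assms 2[of "\<delta> r" "Suc i"] by (simp add: inv_poly_shift_def)
  have "sh (scale p (\<sigma> r)) i \<oplus>\<^bsub>M\<^esub> sh (scale (sh p) (\<delta> r)) i
      = (\<Oplus>\<^bsub>M\<^esub>k\<in>{..n}. p (Suc k) \<bullet>\<^bsub>M\<^esub> ws (Suc k) (Suc i) (\<sigma> r) \<oplus>\<^bsub>M\<^esub> p (Suc k) \<bullet>\<^bsub>M\<^esub> ws k (Suc i) (\<delta> r))"
    unfolding 1 3 using assms n by (intro M.finsum_addf[symmetric]) auto
  also have "\<dots> = (\<Oplus>\<^bsub>M\<^esub>k\<in>{..n}. p (Suc k) \<bullet>\<^bsub>M\<^esub> ws k i r)"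
    using assms n
    by (intro M.finsum_cong') (auto simp: rsmult_r_distr[symmetric] word_sum_Suc_Suc_sigma)
  also have "\<dots> = scale (sh p) r i"
    using 2[OF assms(2)] by simp
  finally show "scale (sh p) r i = sh (scale p (\<sigma> r)) i \<oplus>\<^bsub>M\<^esub> sh (scale (sh p) (\<delta> r)) i"
    by simp
qed

section \<open>The action of \<open>A\<close> and its associativity\<close>

lemma rsmult_eq:
  assumes "p \<in> coeff_seqs M" "a \<in> carrier A" "\<And>j. j > n \<Longrightarrow> lc a j = \<zero>\<^bsub>R\<^esub>"
  shows "(p \<bullet>\<^bsub>P\<^esub> a) i = (\<Oplus>\<^bsub>M\<^esub>j\<in>{..n}. scale p (lc a j) (i + j))"
proof -
  have "(p \<bullet>\<^bsub>P\<^esub> a) i = (\<Oplus>\<^bsub>M\<^esub>j\<in>{j. lc a j \<noteq> \<zero>\<^bsub>R\<^esub>}. scale p (lc a j) (i + j))"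
    by (simp add: inv_poly_module_def inv_poly_shift_def Let_def)
  also have "\<dots> = (\<Oplus>\<^bsub>M\<^esub>j\<in>{..n}. scale p (lc a j) (i + j))"
    using assms
    by (intro M.add.finprod_mono_neutral_cong_left)
      (auto simp: not_less[symmetric] intro!: coeff_seqs_closed[OF scale_closed])
  finally show ?thesis .
qed

lemma lc_bound:
  assumes "a \<in> carrier A"
  obtains n where "\<And>j. j > n \<Longrightarrow> lc a j = \<zero>\<^bsub>R\<^esub>"
  using left_coeffs_seq[OF assms] unfolding coeff_seqs_iff by blast

lemma poly_rsmult_closed [simp, intro]:
  assumes "p \<in> coeff_seqs M" "a \<in> carrier A"
  shows "p \<bullet>\<^bsub>P\<^esub> a \<in> coeff_seqs M"
proof -
  obtain n where n: "\<And>j. j > n \<Longrightarrow> lc a j = \<zero>\<^bsub>R\<^esub>"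
    using lc_bound[OF assms(2)] by blast
  obtain m where m: "\<And>i. p i \<in> carrier M" "\<And>i. i > m \<Longrightarrow> p i = \<zero>\<^bsub>M\<^esub>"
    using assms(1) by (rule coeff_seqsE) blast
  have "scale p r i = \<zero>\<^bsub>M\<^esub>" if "i > m" "r \<in> carrier R" for i r
    using that assms m by (auto simp: scale_eq[where n = m] intro!: M.finsum_zeroI)
  then show ?thesis
    using assms
    by (intro coeff_seqsI[where n = m])
      (auto simp: rsmult_eq[where n = n] n
        intro!: M.finsum_closed M.finsum_zeroI coeff_seqs_closed[OF scale_closed])
qed

lemma poly_rsmult_add_left:
  assumes "p \<in> coeff_seqs M" "q \<in> coeff_seqs M" "a \<in> carrier A"
  shows "(\<lambda>i. p i \<oplus>\<^bsub>M\<^esub> q i) \<bullet>\<^bsub>P\<^esub> a = (\<lambda>i. (p \<bullet>\<^bsub>P\<^esub> a) i \<oplus>\<^bsub>M\<^esub> (q \<bullet>\<^bsub>P\<^esub> a) i)"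
proof
  fix i
  obtain n where n: "\<And>j. j > n \<Longrightarrow> lc a j = \<zero>\<^bsub>R\<^esub>"
    using lc_bound[OF assms(3)] by blast
  show "((\<lambda>i. p i \<oplus>\<^bsub>M\<^esub> q i) \<bullet>\<^bsub>P\<^esub> a) i = (p \<bullet>\<^bsub>P\<^esub> a) i \<oplus>\<^bsub>M\<^esub> (q \<bullet>\<^bsub>P\<^esub> a) i"
    using assms n coeff_seqs_closed[OF scale_closed]
    by (simp add: rsmult_eq[where n = n] M.coeff_seqs_add scale_add_left M.finsum_addf Pi_iff)
qed

lemma poly_rsmult_add_right:
  assumes "p \<in> coeff_seqs M" "a \<in> carrier A" "b \<in> carrier A"
  shows "p \<bullet>\<^bsub>P\<^esub> (a \<oplus>\<^bsub>A\<^esub> b) = (\<lambda>i. (p \<bullet>\<^bsub>P\<^esub> a) i \<oplus>\<^bsub>M\<^esub> (p \<bullet>\<^bsub>P\<^esub> b) i)"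
proof
  fix i
  obtain n where n: "\<And>j. j > n \<Longrightarrow> lc a j = \<zero>\<^bsub>R\<^esub>"
    using lc_bound[OF assms(2)] by blast
  obtain m where m: "\<And>j. j > m \<Longrightarrow> lc b j = \<zero>\<^bsub>R\<^esub>"
    using lc_bound[OF assms(3)] by blast
  show "(p \<bullet>\<^bsub>P\<^esub> (a \<oplus>\<^bsub>A\<^esub> b)) i = (p \<bullet>\<^bsub>P\<^esub> a) i \<oplus>\<^bsub>M\<^esub> (p \<bullet>\<^bsub>P\<^esub> b) i"
    using assms n m coeff_seqs_closed[OF scale_closed]
    by (simp add: rsmult_eq[where n = "max n m"] left_coeffs_add scale_add_right
        M.finsum_addf Pi_iff)
qed

lemma poly_rsmult_embed:
  assumes "p \<in> coeff_seqs M" "r \<in> carrier R"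
  shows "p \<bullet>\<^bsub>P\<^esub> \<iota> r = scale p r"
proof
  show "(p \<bullet>\<^bsub>P\<^esub> \<iota> r) i = scale p r i" for i
    using assms coeff_seqs_closed[OF scale_closed]
    by (subst rsmult_eq[where n = 0]) (auto simp: left_coeffs_embed)
qed

lemma poly_rsmult_zero: "p \<in> coeff_seqs M \<Longrightarrow> p \<bullet>\<^bsub>P\<^esub> \<zero>\<^bsub>A\<^esub> = (\<lambda>i. \<zero>\<^bsub>M\<^esub>)"
  using poly_rsmult_embed[of p "\<zero>\<^bsub>R\<^esub>"] by simp

lemma poly_rsmult_mult_x:
  assumes "p \<in> coeff_seqs M" "a \<in> carrier A"
  shows "p \<bullet>\<^bsub>P\<^esub> (a \<otimes>\<^bsub>A\<^esub> x) = sh (p \<bullet>\<^bsub>P\<^esub> a)"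
proof
  fix i
  obtain n where n: "\<And>j. j > n \<Longrightarrow> lc a j = \<zero>\<^bsub>R\<^esub>"
    using lc_bound[OF assms(2)] by blast
  have c: "case_nat \<zero>\<^bsub>R\<^esub> (lc a) j \<in> carrier R" for j
    using assms by (cases j) auto
  have "(p \<bullet>\<^bsub>P\<^esub> (a \<otimes>\<^bsub>A\<^esub> x)) i = (\<Oplus>\<^bsub>M\<^esub>j\<in>{..Suc n}. scale p (case_nat \<zero>\<^bsub>R\<^esub> (lc a) j) (i + j))"
    using assms n by (subst rsmult_eq[where n = "Suc n"])
      (auto simp: left_coeffs_mult_x split: nat.split)
  also have "\<dots> = (\<Oplus>\<^bsub>M\<^esub>j\<in>{..n}. scale p (lc a j) (i + Suc j))"
    using assms c coeff_seqs_closed[OF scale_closed]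
    by (subst M.finsum_Suc2) (auto intro!: M.finsum_closed)
  also have "\<dots> = sh (p \<bullet>\<^bsub>P\<^esub> a) i"
    using assms n by (simp add: inv_poly_shift_def rsmult_eq[where n = n])
  finally show "(p \<bullet>\<^bsub>P\<^esub> (a \<otimes>\<^bsub>A\<^esub> x)) i = sh (p \<bullet>\<^bsub>P\<^esub> a) i" .
qed

lemma poly_rsmult_embed_mult:
  assumes "p \<in> coeff_seqs M" "r \<in> carrier R" "a \<in> carrier A"
  shows "p \<bullet>\<^bsub>P\<^esub> (\<iota> r \<otimes>\<^bsub>A\<^esub> a) = scale p r \<bullet>\<^bsub>P\<^esub> a"
proof
  fix i
  obtain n where n: "\<And>j. j > n \<Longrightarrow> lc a j = \<zero>\<^bsub>R\<^esub>"
    using lc_bound[OF assms(3)] by blast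
  show "(p \<bullet>\<^bsub>P\<^esub> (\<iota> r \<otimes>\<^bsub>A\<^esub> a)) i = (scale p r \<bullet>\<^bsub>P\<^esub> a) i"
    using assms n by (simp add: rsmult_eq[where n = n] left_coeffs_embed_mult scale_scale)
qed

text \<open>Expanding \<open>x r\<close> by the commutation rule brings back
  \<open>x \<delta>(r)\<close>, so the left side obeys the recursion that \<open>scale_shift\<close>
  gives for the right side. Local nilpotency of \<delta> makes the recursion end at zero; hence the
  induction on the exponent with \<open>r\<close> arbitrary.\<close>

lemma poly_rsmult_x_embed:
  assumes "p \<in> coeff_seqs M" "r \<in> carrier R"
  shows "p \<bullet>\<^bsub>P\<^esub> (x \<otimes>\<^bsub>A\<^esub> \<iota> r) = scale (sh p) r"
proof -
  have "p \<bullet>\<^bsub>P\<^esub> (x \<otimes>\<^bsub>A\<^esub> \<iota> r) = scale (sh p) r" if "(\<delta> ^^ n) r = \<zero>\<^bsub>R\<^esub>" "r \<in> carrier R" for n r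
    using that
  proof (induction n arbitrary: r)
    case 0
    then show ?case
      using assms(1) by (simp add: poly_rsmult_zero inv_poly_shift_closed)
  next
    case (Suc n)
    then have *: "p \<bullet>\<^bsub>P\<^esub> (x \<otimes>\<^bsub>A\<^esub> \<iota> (\<delta> r)) = scale (sh p) (\<delta> r)"
      by (simp add: funpow_swap1)
    have "p \<bullet>\<^bsub>P\<^esub> (x \<otimes>\<^bsub>A\<^esub> \<iota> r) = p \<bullet>\<^bsub>P\<^esub> (\<iota> (\<sigma> r) \<otimes>\<^bsub>A\<^esub> x \<oplus>\<^bsub>A\<^esub> x \<otimes>\<^bsub>A\<^esub> \<iota> (\<delta> r) \<otimes>\<^bsub>A\<^esub> x)"
      using Suc.prems(2) by (simp only: commutation)
    also have "\<dots> = (\<lambda>i. sh (scale p (\<sigma> r)) i \<oplus>\<^bsub>M\<^esub> sh (scale (sh p) (\<delta> r)) i)"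
      using assms(1) Suc.prems(2)
      by (simp add: poly_rsmult_add_right poly_rsmult_mult_x poly_rsmult_embed *)
    also have "\<dots> = scale (sh p) r"
      using assms(1) Suc.prems(2) by (simp only: scale_shift[symmetric])
    finally show ?case .
  qed
  moreover obtain n where "(\<delta> ^^ n) r = \<zero>\<^bsub>R\<^esub>"
    using delta_nilpotent assms(2) by (auto simp: locally_nilpotent_def)
  ultimately show ?thesis
    using assms(2) by blast
qed

text \<open>The passage from \<open>R\<close> to all of \<open>A\<close> uses
  \<open>x (r + a x) = x r + (x a) x\<close>: the new factor \<open>x\<close> stands on the right,
  where it acts as a shift.\<close>

lemma poly_rsmult_x_mult:
  assumes "a \<in> carrier A" "p \<in> coeff_seqs M"
  shows "p \<bullet>\<^bsub>P\<^esub> (x \<otimes>\<^bsub>A\<^esub> a) = sh p \<bullet>\<^bsub>P\<^esub> a"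
  using assms
proof (induction rule: Ore_induct)
  case zero
  then show ?case
    by (simp add: poly_rsmult_zero inv_poly_shift_closed)
next
  case (step r a)
  have "x \<otimes>\<^bsub>A\<^esub> (\<iota> r \<oplus>\<^bsub>A\<^esub> a \<otimes>\<^bsub>A\<^esub> x) = x \<otimes>\<^bsub>A\<^esub> \<iota> r \<oplus>\<^bsub>A\<^esub> (x \<otimes>\<^bsub>A\<^esub> a) \<otimes>\<^bsub>A\<^esub> x"
    using step by (simp add: A.r_distr A.m_assoc)
  then show ?case
    using step
    by (simp add: poly_rsmult_add_right poly_rsmult_x_embed poly_rsmult_embed poly_rsmult_mult_x
        inv_poly_shift_closed)
qed

text \<open>Induction on the left factor in Horner form. The right factor is arbitrary because
  \<open>(b x) a\<close> is regrouped as \<open>b (x a)\<close>, and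
  \<open>poly_rsmult_x_mult\<close> then turns the transferred \<open>x\<close> into a
  shift.\<close>

lemma poly_rsmult_assoc:
  assumes "b \<in> carrier A" "p \<in> coeff_seqs M" "a \<in> carrier A"
  shows "p \<bullet>\<^bsub>P\<^esub> (b \<otimes>\<^bsub>A\<^esub> a) = (p \<bullet>\<^bsub>P\<^esub> b) \<bullet>\<^bsub>P\<^esub> a"
  using assms
proof (induction arbitrary: a rule: Ore_induct)
  case zero
  \<comment> \<open>Writing zero as the image of zero in \<open>R\<close> also yields that
    \<open>a\<close> annihilates the zero polynomial.\<close>
  then show ?case
    using poly_rsmult_embed_mult[of p "\<zero>\<^bsub>R\<^esub>" a] by (simp add: poly_rsmult_zero)
next
  case (step r b)
  have "(\<iota> r \<oplus>\<^bsub>A\<^esub> b \<otimes>\<^bsub>A\<^esub> x) \<otimes>\<^bsub>A\<^esub> a = \<iota> r \<otimes>\<^bsub>A\<^esub> a \<oplus>\<^bsub>A\<^esub> b \<otimes>\<^bsub>A\<^esub> (x \<otimes>\<^bsub>A\<^esub> a)"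
    using step by (simp add: A.l_distr A.m_assoc)
  then show ?case
    using step
    by (simp add: poly_rsmult_add_right poly_rsmult_add_left poly_rsmult_embed_mult
        poly_rsmult_embed poly_rsmult_mult_x poly_rsmult_x_mult inv_poly_shift_closed)
qed

section \<open>The \<open>A\<close>-module of inverse polynomials and its submodules\<close>

lemma inv_poly_module_sel [simp]:
  "carrier P = coeff_seqs M" "\<zero>\<^bsub>P\<^esub> = (\<lambda>i. \<zero>\<^bsub>M\<^esub>)" "p \<oplus>\<^bsub>P\<^esub> q = (\<lambda>i. p i \<oplus>\<^bsub>M\<^esub> q i)"
  by (simp_all add: inv_poly_module_def)

lemma inv_poly_uminus_closed:
  assumes "p \<in> coeff_seqs M"
  shows "(\<lambda>i. \<ominus>\<^bsub>M\<^esub> p i) \<in> coeff_seqs M"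
proof -
  obtain n where n: "\<And>i. p i \<in> carrier M" "\<And>i. i > n \<Longrightarrow> p i = \<zero>\<^bsub>M\<^esub>"
    using assms by (rule coeff_seqsE) blast
  show ?thesis
    by (rule coeff_seqsI[where n = n]) (auto simp: n)
qed

lemma abelian_group_inv_poly: "abelian_group P"
proof (rule abelian_groupI)
  fix p assume p: "p \<in> carrier P"
  then show "\<exists>q\<in>carrier P. q \<oplus>\<^bsub>P\<^esub> p = \<zero>\<^bsub>P\<^esub>"
    using inv_poly_uminus_closed[of p] coeff_seqs_closed[of p M]
    by (intro bexI[where x = "\<lambda>i. \<ominus>\<^bsub>M\<^esub> p i"]) (auto simp: M.l_neg)
qed (auto simp: M.coeff_seqs_zero M.coeff_seqs_add coeff_seqs_closed M.a_assoc
    intro: M.a_comm coeff_seqs_closed)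

lemma right_module_inv_poly: "right_module A P"
proof (intro right_module.intro right_module_axioms.intro)
  fix p assume p: "p \<in> carrier P"
  show "p \<bullet>\<^bsub>P\<^esub> \<one>\<^bsub>A\<^esub> = p"
    using p poly_rsmult_embed[of p "\<one>\<^bsub>R\<^esub>"] by (simp add: scale_one)
qed (auto simp: A.ring_axioms abelian_group_inv_poly poly_rsmult_add_left poly_rsmult_add_right
    poly_rsmult_assoc)

text \<open>Negation in \<open>P\<close> is determined by its addition and zero, so the
  coefficientwise formula comes from uniqueness of inverses.\<close>

lemma inv_poly_minus:
  assumes "p \<in> coeff_seqs M"
  shows "\<ominus>\<^bsub>P\<^esub> p = (\<lambda>i. \<ominus>\<^bsub>M\<^esub> p i)"
proof -
  interpret P: abelian_group P
    by (rule abelian_group_inv_poly)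
  show ?thesis
    using assms inv_poly_uminus_closed[of p] coeff_seqs_closed[of p M]
    by (intro P.minus_equality) (auto simp: M.l_neg)
qed

lemma right_submodule_inv_poly_sub:
  assumes "right_submodule N R M"
  shows "right_submodule (inv_poly_sub M N) A P"
proof -
  interpret N: right_submodule N R M
    by (rule assms)
  interpret P: right_module A P
    by (rule right_module_inv_poly)
  show ?thesis
  proof (intro right_submodule.intro right_submodule_axioms.intro right_module_inv_poly
      additive_subgroupI P.add.subgroupI)
    show "inv_poly_sub M N \<subseteq> carrier P"
      by (auto simp: inv_poly_sub_def)
    show "inv_poly_sub M N \<noteq> {}"
      using M.coeff_seqs_zero by (auto simp: inv_poly_sub_def)
    show "\<ominus>\<^bsub>P\<^esub> p \<in> inv_poly_sub M N" if "p \<in> inv_poly_sub M N" for p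
      using that by (auto simp: inv_poly_sub_def inv_poly_minus inv_poly_uminus_closed)
    show "p \<oplus>\<^bsub>P\<^esub> q \<in> inv_poly_sub M N" if "p \<in> inv_poly_sub M N" "q \<in> inv_poly_sub M N" for p q
      using that by (auto simp: inv_poly_sub_def M.coeff_seqs_add)
    show "p \<bullet>\<^bsub>P\<^esub> a \<in> inv_poly_sub M N" if "p \<in> inv_poly_sub M N" "a \<in> carrier A" for p a
    proof -
      have p: "p \<in> coeff_seqs M" "p i \<in> N" for i
        using that(1) by (auto simp: inv_poly_sub_def)
      obtain n where n: "\<And>i. i > n \<Longrightarrow> p i = \<zero>\<^bsub>M\<^esub>"
        using p(1) by (rule coeff_seqsE) blast
      \<comment> \<open>Each coefficient is a finite sum of elements of \<open>N\<close> multiplied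
        by ring elements.\<close>
      have *: "scale p r i \<in> N" if "r \<in> carrier R" for r i
        using \<open>r \<in> carrier R\<close> p n
        by (auto simp: scale_eq[where n = n] intro!: N.rsub_finsum_closed N.sub_rsmult_closed)
      obtain m where m: "\<And>j. j > m \<Longrightarrow> lc a j = \<zero>\<^bsub>R\<^esub>"
        using lc_bound[OF \<open>a \<in> carrier A\<close>] by blast
      show ?thesis
        using \<open>a \<in> carrier A\<close> p m
        by (auto simp: inv_poly_sub_def rsmult_eq[where n = m] intro!: N.rsub_finsum_closed *)
    qed
  qed
qed

section \<open>Essentiality\<close>

lemma poly_rsmult_x_pow:
  fixes n :: nat
  assumes "p \<in> coeff_seqs M"
  shows "p \<bullet>\<^bsub>P\<^esub> (x [^]\<^bsub>A\<^esub> n) = inv_poly_shift p n"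
proof (induction n)
  case 0
  then show ?case
    using assms poly_rsmult_embed[of p "\<one>\<^bsub>R\<^esub>"] by (simp add: scale_one inv_poly_shift_def)
next
  case (Suc n)
  then show ?case
    using assms by (simp add: poly_rsmult_mult_x inv_poly_shift_def add.commute)
qed

lemma essential_submodule_inv_poly_sub:
  assumes "essential_submodule N R M"
  shows "essential_submodule (inv_poly_sub M N) A P"
proof -
  interpret N: essential_submodule N R M
    by (rule assms)
  show ?thesis
  proof (intro essential_submodule.intro essential_submodule_axioms.intro
      right_submodule_inv_poly_sub N.right_submodule_axioms)
    fix p assume "p \<in> carrier P" and nz: "p \<noteq> \<zero>\<^bsub>P\<^esub>"
    then have p: "p \<in> coeff_seqs M"
      by simp
    \<comment> \<open>The degree of \<open>p\<close>; the maximum is taken over a finite nonempty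
      set because \<open>p\<close> is nonzero.\<close>
    define d where "d = Max {i. p i \<noteq> \<zero>\<^bsub>M\<^esub>}"
    have fin: "finite {i. p i \<noteq> \<zero>\<^bsub>M\<^esub>}" and ne: "{i. p i \<noteq> \<zero>\<^bsub>M\<^esub>} \<noteq> {}"
      using p nz by (auto simp: coeff_seqs_def fun_eq_iff)
    have d: "p d \<noteq> \<zero>\<^bsub>M\<^esub>" "p d \<in> carrier M"
      using Max_in[OF fin ne] coeff_seqs_closed[OF p] by (auto simp: d_def)
    have gt: "p i = \<zero>\<^bsub>M\<^esub>" if "i > d" for i
      using that Max_ge[OF fin, of i] by (force simp: d_def)
    \<comment> \<open>Essentiality states that an intersection differs from the zero set, which an
      empty set would satisfy too. Exhibiting zero as a member leaves a nonzero element to be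
      chosen.\<close>
    have "\<zero>\<^bsub>M\<^esub> \<in> (\<lambda>r. p d \<bullet>\<^bsub>M\<^esub> r) ` carrier R \<inter> N"
      using d by (auto intro: image_eqI[where x = "\<zero>\<^bsub>R\<^esub>"])
    with N.essential[OF d(2,1)] obtain r
      where r: "r \<in> carrier R" "p d \<bullet>\<^bsub>M\<^esub> r \<in> N" "p d \<bullet>\<^bsub>M\<^esub> r \<noteq> \<zero>\<^bsub>M\<^esub>"
      by blast
    \<comment> \<open>The power of \<open>x\<close> shifts \<open>p\<close> down to its leading
      coefficient as a constant, and \<open>r\<close> then carries that constant into
      \<open>N\<close>.\<close>
    let ?q = "p \<bullet>\<^bsub>P\<^esub> (x [^]\<^bsub>A\<^esub> d \<otimes>\<^bsub>A\<^esub> \<iota> r)"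
    have sh: "inv_poly_shift p d \<in> coeff_seqs M" "inv_poly_shift p d 0 = p d"
      "i > 0 \<Longrightarrow> inv_poly_shift p d i = \<zero>\<^bsub>M\<^esub>" for i
      using gt inv_poly_shift_closed[OF p] by (auto simp: inv_poly_shift_def)
    have "?q = scale (inv_poly_shift p d) r"
      using p r(1) sh(1) by (simp add: poly_rsmult_assoc poly_rsmult_x_pow poly_rsmult_embed)
    \<comment> \<open>Only the term at index zero survives. As \<open>ws 0 i r\<close> is
      \<open>r\<close> for \<open>i = 0\<close> and zero otherwise, \<open>?q\<close> is a constant
      with value in \<open>N\<close>.\<close>
    then have q: "?q i = p d \<bullet>\<^bsub>M\<^esub> ws 0 i r" for i
      using r(1) d(2) sh by (simp add: scale_eq[where n = 0])
    have "?q i \<in> N" for i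
      using q[of i] r(1,2) d(2) by (cases i) auto
    then have "?q \<in> inv_poly_sub M N"
      using p r(1) by (auto simp: inv_poly_sub_def)
    moreover have "?q \<noteq> \<zero>\<^bsub>P\<^esub>"
      using q[of 0] r(1,3) by (auto dest: fun_cong[of _ _ 0])
    moreover have "?q \<in> (\<lambda>a. p \<bullet>\<^bsub>P\<^esub> a) ` carrier A"
      using r(1) by auto
    ultimately show "(\<lambda>a. p \<bullet>\<^bsub>P\<^esub> a) ` carrier A \<inter> inv_poly_sub M N \<noteq> {\<zero>\<^bsub>P\<^esub>}"
      by blast
  qed
qed

end

theorem lemma3p1:
  fixes R :: "('r, 'b) ring_scheme"
    and \<sigma> \<delta> :: "'r \<Rightarrow> 'r"
    and A :: "('a, 'd) ring_scheme"
    and \<iota> :: "'r \<Rightarrow> 'a" and x :: 'a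
    and M :: "('m, 'r, 'c) right_module_scheme"
    and N :: "'m set"
  assumes "ring R"
    and "\<sigma> \<in> ring_iso R R"
    and "skew_derivation R \<sigma> \<delta>"
    and "locally_nilpotent R \<delta>"
    and "skew_Ore_ring R A \<sigma> \<delta> \<iota> x"
    and "right_module R M"
    and "completely_compatible R \<sigma> \<delta> M"
    and "essential_submodule N R M"
  shows "essential_submodule (inv_poly_sub M N) A (inv_poly_module R \<sigma> \<delta> A \<iota> x M)"
proof -
  interpret inv_poly_setting R A \<sigma> \<delta> \<iota> x M
    using assms
    by (intro inv_poly_setting.intro skew_Ore_autom.intro skew_Ore_autom_axioms.intro)
  show ?thesis
    using assms(8) by (rule essential_submodule_inv_poly_sub)
qed

end
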